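(* Let $\mathcal{C}$ be a semi-monoidal 2-category, let $(I_0,\alpha_0)$ and $(I_1,\alpha_1)$ be unit objects in $\mathcal{C}$, with canonical associators $A_0: I_0\alpha_0\Rightarrow\alpha_0I_0$ and $A_1: I_1\alpha_1\Rightarrow\alpha_1I_1$ respectively. If $(u,U):(I_0,\alpha_0)\to(I_1,\alpha_1)$ is a morphism of units, then it is automatically a semi-monoid map; that is, $$(A_0\,\#\,uu)\bullet(Uu)=(uU)\bullet(uuu\,\#\,A_1)$$ as 2-cells $I_0\alpha_0\,\#\,uu\Rightarrow uuu\,\#\,\alpha_1I_1$.
   Context: A semi-monoidal 2-category $\mathcal{C}$ is a strict 2-category with a strict 2-functor $\mathcal{C}\times\mathcal{C}\to\mathcal{C}$, $(X,Y)\mapsto XY$ (tensor product, written by juxtaposition), strictly associative. No unit is assumed. $\#$ denotes composition of arrows and horizontal composition of 2-cells (including whiskering), written left to right; $\bullet$ denotes vertical composition of 2-cells, also left to right. The name of an object (arrow) also denotes its identity arrow (identity 2-cell); thus $Uu=U\otimes\mathrm{id}_u$. An equi-arrow is an arrow admitting a pseudo-inverse. An object $I$ is cancellable if $X\mapsto IX$ and $X\mapsto XI$ are fully faithful 2-functors, i.e. induce equivalences on hom categories. A unit object is a pair $(I,\alpha)$ with $I$ cancellable and $\alpha: II\to I$ an equi-arrow. A morphism of units $(I,\alpha)\to(J,\beta)$ is a pair $(u,U)$ with $u:I\to J$ an equi-arrow and $U:\alpha\#u\Rightarrow uu\#\beta$ an invertible 2-cell. Canonical associator of a unit $(I,\alpha)$: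 choose equi-arrows $\lambda_I,\rho_I: II\to I$ and invertible 2-cells $L_I: I\lambda_I\Rightarrow\alpha I$, $R_I: I\alpha\Rightarrow\rho_II$ (these exist). Then $A: I\alpha\Rightarrow\alpha I$ is the unique 2-cell with $$(IL_I^{-1}\,\#\,R_I)\bullet(R_I^{-1}I\,\#\,L_I)=I\alpha I\,\#\,A$$ (composite $I\alpha I\# I\alpha\Rightarrow II\lambda_I\#\rho_I I=\rho_I II\# I\lambda_I\Rightarrow I\alpha I\#\alpha I$); it is invertible and independent of the choices. The unit is regarded as a semi-monoid $(I,\alpha,A\#\alpha)$. A semi-monoid is $(X,\alpha,\mathring{A})$ with $\alpha:XX\to X$ and $\mathring{A}: X\alpha\#\alpha\Rightarrow\alpha X\#\alpha$ invertible satisfying the pentagon equation. A semi-monoid map $(X,\alpha,\mathring{A})\to(Y,\beta,\mathring{B})$ is an arrow $f:X\to Y$ with an invertible 2-cell $F:\alpha\#f\Rightarrow ff\#\beta$ such that $(\mathring{A}\#f)\bullet(\alpha X\#F)\bullet(Ff\#\beta)=(X\alpha\#F)\bullet(fF\#\beta)\bullet(fff\#\mathring{B})$. When $\mathring{A}=A\#\alpha$, $\mathring{B}=B\#\beta$ and $\beta$ is an equi-arrow this is equivalent to $(A\#ff)\bullet(Ff)=(fF)\bullet(fff\#B)$. *)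

theory Defs
  imports Main
begin

section \<open>Categories and equivalences of categories\<close>

text \<open>Composition is written in diagrammatic order throughout: \<open>cmp D m n\<close> is
  \<open>m\<close> followed by \<open>n\<close>. All operations are total functions, constrained only on the carriers.\<close>

record ('x, 'm) cat =
  ob  :: "'x set"
  mor :: "'m set"
  src :: "'m \<Rightarrow> 'x"
  tgt :: "'m \<Rightarrow> 'x"
  idn :: "'x \<Rightarrow> 'm"
  cmp :: "'m \<Rightarrow> 'm \<Rightarrow> 'm"

definition homs :: "('x, 'm, 'r) cat_scheme \<Rightarrow> 'x \<Rightarrow> 'x \<Rightarrow> 'm set" where
  "homs D x y = {m \<in> mor D. src D m = x \<and> tgt D m = y}"

locale category =
  fixes D :: "('x, 'm, 'r) cat_scheme" (structure)
  assumes src_ob: "m \<in> mor D \<Longrightarrow> src D m \<in> ob D"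
    and tgt_ob: "m \<in> mor D \<Longrightarrow> tgt D m \<in> ob D"
    and idn_homs: "x \<in> ob D \<Longrightarrow> idn D x \<in> homs D x x"
    and cmp_homs: "\<lbrakk>m \<in> homs D x y; n \<in> homs D y z\<rbrakk> \<Longrightarrow> cmp D m n \<in> homs D x z"
    and idn_left: "m \<in> homs D x y \<Longrightarrow> cmp D (idn D x) m = m"
    and idn_right: "m \<in> homs D x y \<Longrightarrow> cmp D m (idn D y) = m"
    and cmp_assoc: "\<lbrakk>m \<in> homs D w x; n \<in> homs D x y; p \<in> homs D y z\<rbrakk>
        \<Longrightarrow> cmp D (cmp D m n) p = cmp D m (cmp D n p)"

definition isomorphism :: "('x, 'm, 'r) cat_scheme \<Rightarrow> 'm \<Rightarrow> 'x \<Rightarrow> 'x \<Rightarrow> bool" where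
  "isomorphism D m x y \<longleftrightarrow>
     m \<in> homs D x y \<and> (\<exists>n \<in> homs D y x. cmp D m n = idn D x \<and> cmp D n m = idn D y)"

locale cat_functor =
  source: category D + target: category E
  for D :: "('x, 'm, 'r) cat_scheme" and E :: "('y, 'n, 's) cat_scheme" +
  fixes F0 :: "'x \<Rightarrow> 'y" and F1 :: "'m \<Rightarrow> 'n"
  assumes F0_ob: "x \<in> ob D \<Longrightarrow> F0 x \<in> ob E"
    and F1_homs: "m \<in> homs D x y \<Longrightarrow> F1 m \<in> homs E (F0 x) (F0 y)"
    and F1_idn: "x \<in> ob D \<Longrightarrow> F1 (idn D x) = idn E (F0 x)"
    and F1_cmp: "\<lbrakk>m \<in> homs D x y; n \<in> homs D y z\<rbrakk>
        \<Longrightarrow> F1 (cmp D m n) = cmp E (F1 m) (F1 n)"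

definition natural_iso ::
  "('x, 'm, 'r) cat_scheme \<Rightarrow> ('y, 'n, 's) cat_scheme \<Rightarrow>
   ('x \<Rightarrow> 'y) \<Rightarrow> ('m \<Rightarrow> 'n) \<Rightarrow> ('x \<Rightarrow> 'y) \<Rightarrow> ('m \<Rightarrow> 'n) \<Rightarrow> ('x \<Rightarrow> 'n) \<Rightarrow> bool" where
  "natural_iso D E F0 F1 G0 G1 \<tau> \<longleftrightarrow>
     (\<forall>x \<in> ob D. isomorphism E (\<tau> x) (F0 x) (G0 x)) \<and>
     (\<forall>x y. \<forall>m \<in> homs D x y. cmp E (F1 m) (\<tau> y) = cmp E (\<tau> x) (G1 m))"

definition equivalence_of_categories ::
  "('x, 'm, 'r) cat_scheme \<Rightarrow> ('y, 'n, 's) cat_scheme \<Rightarrow> ('x \<Rightarrow> 'y) \<Rightarrow> ('m \<Rightarrow> 'n) \<Rightarrow> bool" where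
  "equivalence_of_categories D E F0 F1 \<longleftrightarrow>
     cat_functor D E F0 F1 \<and>
     (\<exists>G0 G1 \<eta> \<epsilon>. cat_functor E D G0 G1 \<and>
        natural_iso D D id id (G0 \<circ> F0) (G1 \<circ> F1) \<eta> \<and>
        natural_iso E E (F0 \<circ> G0) (F1 \<circ> G1) id id \<epsilon>)"


section \<open>Strict 2-categories and strict 2-functors\<close>

text \<open>Subscript 1 marks operations on arrows, subscript 2 operations on 2-cells. Whiskering is
  horizontal composition with an identity 2-cell.\<close>

record ('o, 'a, 'c) two_cat =
  Obj  :: "'o set"
  Arr  :: "'a set"
  Cell :: "'c set"
  Dom  :: "'a \<Rightarrow> 'o"
  Cod  :: "'a \<Rightarrow> 'o"
  Src  :: "'c \<Rightarrow> 'a"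
  Tgt  :: "'c \<Rightarrow> 'a"
  id1  :: "'o \<Rightarrow> 'a"  (\<open>\<one>\<^sub>1\<index>\<close>)
  id2  :: "'a \<Rightarrow> 'c"  (\<open>\<one>\<^sub>2\<index>\<close>)
  comp1 :: "'a \<Rightarrow> 'a \<Rightarrow> 'a"  (infixl \<open>\<sharp>\<^sub>1\<index>\<close> 75)
  hcomp :: "'c \<Rightarrow> 'c \<Rightarrow> 'c"  (infixl \<open>\<sharp>\<^sub>2\<index>\<close> 75)
  vcomp :: "'c \<Rightarrow> 'c \<Rightarrow> 'c"  (infixl \<open>\<bullet>\<index>\<close> 70)

definition hom1 :: "('o, 'a, 'c, 'r) two_cat_scheme \<Rightarrow> 'o \<Rightarrow> 'o \<Rightarrow> 'a set" where
  "hom1 C X Y = {f \<in> Arr C. Dom C f = X \<and> Cod C f = Y}"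

definition hom2 :: "('o, 'a, 'c, 'r) two_cat_scheme \<Rightarrow> 'a \<Rightarrow> 'a \<Rightarrow> 'c set" where
  "hom2 C f g = {s \<in> Cell C. Src C s = f \<and> Tgt C s = g}"

locale two_category =
  fixes C :: "('o, 'a, 'c, 'r) two_cat_scheme" (structure)
  assumes Dom_Obj: "f \<in> Arr C \<Longrightarrow> Dom C f \<in> Obj C"
    and Cod_Obj: "f \<in> Arr C \<Longrightarrow> Cod C f \<in> Obj C"
    and Src_Arr: "s \<in> Cell C \<Longrightarrow> Src C s \<in> Arr C"
    and Tgt_Arr: "s \<in> Cell C \<Longrightarrow> Tgt C s \<in> Arr C"
    and Dom_Src: "s \<in> Cell C \<Longrightarrow> Dom C (Src C s) = Dom C (Tgt C s)"
    and Cod_Src: "s \<in> Cell C \<Longrightarrow> Cod C (Src C s) = Cod C (Tgt C s)"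
    \<comment> \<open>arrows\<close>
    and id1_hom: "X \<in> Obj C \<Longrightarrow> \<one>\<^sub>1 X \<in> hom1 C X X"
    and comp_hom: "\<lbrakk>f \<in> hom1 C X Y; g \<in> hom1 C Y Z\<rbrakk> \<Longrightarrow> f \<sharp>\<^sub>1 g \<in> hom1 C X Z"
    and comp_id_left: "f \<in> hom1 C X Y \<Longrightarrow> \<one>\<^sub>1 X \<sharp>\<^sub>1 f = f"
    and comp_id_right: "f \<in> hom1 C X Y \<Longrightarrow> f \<sharp>\<^sub>1 \<one>\<^sub>1 Y = f"
    and comp_assoc: "\<lbrakk>f \<in> hom1 C W X; g \<in> hom1 C X Y; h \<in> hom1 C Y Z\<rbrakk>
        \<Longrightarrow> (f \<sharp>\<^sub>1 g) \<sharp>\<^sub>1 h = f \<sharp>\<^sub>1 (g \<sharp>\<^sub>1 h)"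
    \<comment> \<open>vertical composition\<close>
    and id2_hom: "f \<in> Arr C \<Longrightarrow> \<one>\<^sub>2 f \<in> hom2 C f f"
    and vcomp_hom: "\<lbrakk>s \<in> hom2 C f g; t \<in> hom2 C g h\<rbrakk> \<Longrightarrow> s \<bullet> t \<in> hom2 C f h"
    and vcomp_id_left: "s \<in> hom2 C f g \<Longrightarrow> \<one>\<^sub>2 f \<bullet> s = s"
    and vcomp_id_right: "s \<in> hom2 C f g \<Longrightarrow> s \<bullet> \<one>\<^sub>2 g = s"
    and vcomp_assoc: "\<lbrakk>s \<in> hom2 C f g; t \<in> hom2 C g h; r \<in> hom2 C h k\<rbrakk>
        \<Longrightarrow> (s \<bullet> t) \<bullet> r = s \<bullet> (t \<bullet> r)"
    \<comment> \<open>horizontal composition\<close>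
    and hcomp_hom: "\<lbrakk>s \<in> hom2 C f f'; t \<in> hom2 C g g'; Cod C f = Dom C g\<rbrakk>
        \<Longrightarrow> s \<sharp>\<^sub>2 t \<in> hom2 C (f \<sharp>\<^sub>1 g) (f' \<sharp>\<^sub>1 g')"
    and hcomp_id_left: "\<lbrakk>s \<in> hom2 C f g; Dom C f = X\<rbrakk> \<Longrightarrow> \<one>\<^sub>2 (\<one>\<^sub>1 X) \<sharp>\<^sub>2 s = s"
    and hcomp_id_right: "\<lbrakk>s \<in> hom2 C f g; Cod C f = Y\<rbrakk> \<Longrightarrow> s \<sharp>\<^sub>2 \<one>\<^sub>2 (\<one>\<^sub>1 Y) = s"
    and hcomp_assoc: "\<lbrakk>s \<in> hom2 C f f'; t \<in> hom2 C g g'; r \<in> hom2 C h h';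
          Cod C f = Dom C g; Cod C g = Dom C h\<rbrakk>
        \<Longrightarrow> (s \<sharp>\<^sub>2 t) \<sharp>\<^sub>2 r = s \<sharp>\<^sub>2 (t \<sharp>\<^sub>2 r)"
    and hcomp_id2: "\<lbrakk>f \<in> hom1 C X Y; g \<in> hom1 C Y Z\<rbrakk> \<Longrightarrow> \<one>\<^sub>2 f \<sharp>\<^sub>2 \<one>\<^sub>2 g = \<one>\<^sub>2 (f \<sharp>\<^sub>1 g)"
    and interchange: "\<lbrakk>s \<in> hom2 C f f'; s' \<in> hom2 C f' f''; t \<in> hom2 C g g'; t' \<in> hom2 C g' g'';
          Cod C f = Dom C g\<rbrakk>
        \<Longrightarrow> (s \<sharp>\<^sub>2 t) \<bullet> (s' \<sharp>\<^sub>2 t') = (s \<bullet> s') \<sharp>\<^sub>2 (t \<bullet> t')"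

definition hom_cat :: "('o, 'a, 'c, 'r) two_cat_scheme \<Rightarrow> 'o \<Rightarrow> 'o \<Rightarrow> ('a, 'c) cat" where
  "hom_cat C X Y = \<lparr>ob = hom1 C X Y, mor = {s \<in> Cell C. Src C s \<in> hom1 C X Y},
     src = Src C, tgt = Tgt C, idn = id2 C, cmp = vcomp C\<rparr>"

definition prod_2cat ::
  "('o, 'a, 'c, 'r) two_cat_scheme \<Rightarrow> ('p, 'b, 'd, 's) two_cat_scheme \<Rightarrow>
   ('o \<times> 'p, 'a \<times> 'b, 'c \<times> 'd) two_cat" where
  "prod_2cat C D = \<lparr>Obj = Obj C \<times> Obj D, Arr = Arr C \<times> Arr D, Cell = Cell C \<times> Cell D,
     Dom = map_prod (Dom C) (Dom D), Cod = map_prod (Cod C) (Cod D),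
     Src = map_prod (Src C) (Src D), Tgt = map_prod (Tgt C) (Tgt D),
     id1 = map_prod (id1 C) (id1 D), id2 = map_prod (id2 C) (id2 D),
     comp1 = (\<lambda>(f, f') (g, g'). (comp1 C f g, comp1 D f' g')),
     hcomp = (\<lambda>(s, s') (t, t'). (hcomp C s t, hcomp D s' t')),
     vcomp = (\<lambda>(s, s') (t, t'). (vcomp C s t, vcomp D s' t'))\<rparr>"

locale strict_2functor =
  source: two_category C + target: two_category D
  for C :: "('o, 'a, 'c, 'r) two_cat_scheme" and D :: "('p, 'b, 'd, 's) two_cat_scheme" +
  fixes F0 :: "'o \<Rightarrow> 'p" and F1 :: "'a \<Rightarrow> 'b" and F2 :: "'c \<Rightarrow> 'd"
  assumes F0_Obj: "X \<in> Obj C \<Longrightarrow> F0 X \<in> Obj D"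
    and F1_hom: "f \<in> hom1 C X Y \<Longrightarrow> F1 f \<in> hom1 D (F0 X) (F0 Y)"
    and F2_hom: "s \<in> hom2 C f g \<Longrightarrow> F2 s \<in> hom2 D (F1 f) (F1 g)"
    and F1_id1: "X \<in> Obj C \<Longrightarrow> F1 (id1 C X) = id1 D (F0 X)"
    and F1_comp: "\<lbrakk>f \<in> hom1 C X Y; g \<in> hom1 C Y Z\<rbrakk>
        \<Longrightarrow> F1 (comp1 C f g) = comp1 D (F1 f) (F1 g)"
    and F2_id2: "f \<in> Arr C \<Longrightarrow> F2 (id2 C f) = id2 D (F1 f)"
    and F2_vcomp: "\<lbrakk>s \<in> hom2 C f g; t \<in> hom2 C g h\<rbrakk>
        \<Longrightarrow> F2 (vcomp C s t) = vcomp D (F2 s) (F2 t)"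
    and F2_hcomp: "\<lbrakk>s \<in> hom2 C f f'; t \<in> hom2 C g g'; Cod C f = Dom C g\<rbrakk>
        \<Longrightarrow> F2 (hcomp C s t) = hcomp D (F2 s) (F2 t)"

locale fully_faithful_2functor = strict_2functor +
  assumes hom_equivalence: "\<lbrakk>X \<in> Obj C; Y \<in> Obj C\<rbrakk>
    \<Longrightarrow> equivalence_of_categories (hom_cat C X Y) (hom_cat D (F0 X) (F0 Y)) F1 F2"

context
  fixes C :: "('o, 'a, 'c, 'r) two_cat_scheme" (structure)
begin

definition inverse_cells :: "'c \<Rightarrow> 'c \<Rightarrow> bool" where
  "inverse_cells s t \<longleftrightarrow> s \<in> Cell C \<and> t \<in> hom2 C (Tgt C s) (Src C s) \<and>
     s \<bullet> t = \<one>\<^sub>2 (Src C s) \<and> t \<bullet> s = \<one>\<^sub>2 (Tgt C s)"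

definition invertible :: "'c \<Rightarrow> bool" where
  "invertible s \<longleftrightarrow> (\<exists>t. inverse_cells s t)"

definition inv_cell :: "'c \<Rightarrow> 'c" where
  "inv_cell s = (THE t. inverse_cells s t)"

definition equi_arrow :: "'a \<Rightarrow> 'o \<Rightarrow> 'o \<Rightarrow> bool" where
  "equi_arrow f X Y \<longleftrightarrow> f \<in> hom1 C X Y \<and>
     (\<exists>g \<in> hom1 C Y X.
        (\<exists>s \<in> hom2 C (f \<sharp>\<^sub>1 g) (\<one>\<^sub>1 X). invertible s) \<and>
        (\<exists>t \<in> hom2 C (g \<sharp>\<^sub>1 f) (\<one>\<^sub>1 Y). invertible t))"

end


section \<open>Semi-monoidal 2-categories, units and semi-monoid maps\<close>

record ('o, 'a, 'c) semi_monoidal = "('o, 'a, 'c) two_cat" +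
  tensor0 :: "'o \<Rightarrow> 'o \<Rightarrow> 'o"  (infixl \<open>\<otimes>\<^sub>0\<index>\<close> 80)
  tensor1 :: "'a \<Rightarrow> 'a \<Rightarrow> 'a"  (infixl \<open>\<otimes>\<^sub>1\<index>\<close> 80)
  tensor2 :: "'c \<Rightarrow> 'c \<Rightarrow> 'c"  (infixl \<open>\<otimes>\<^sub>2\<index>\<close> 80)

locale semi_monoidal_2category = two_category C
  for C :: "('o, 'a, 'c, 'r) semi_monoidal_scheme" (structure) +
  assumes tensor_2functor: "strict_2functor (prod_2cat C C) C
      (\<lambda>(X, Y). X \<otimes>\<^sub>0 Y) (\<lambda>(f, g). f \<otimes>\<^sub>1 g) (\<lambda>(s, t). s \<otimes>\<^sub>2 t)"
    and tensor0_assoc: "\<lbrakk>X \<in> Obj C; Y \<in> Obj C; Z \<in> Obj C\<rbrakk>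
        \<Longrightarrow> (X \<otimes>\<^sub>0 Y) \<otimes>\<^sub>0 Z = X \<otimes>\<^sub>0 (Y \<otimes>\<^sub>0 Z)"
    and tensor1_assoc: "\<lbrakk>f \<in> Arr C; g \<in> Arr C; h \<in> Arr C\<rbrakk>
        \<Longrightarrow> (f \<otimes>\<^sub>1 g) \<otimes>\<^sub>1 h = f \<otimes>\<^sub>1 (g \<otimes>\<^sub>1 h)"
    and tensor2_assoc: "\<lbrakk>s \<in> Cell C; t \<in> Cell C; r \<in> Cell C\<rbrakk>
        \<Longrightarrow> (s \<otimes>\<^sub>2 t) \<otimes>\<^sub>2 r = s \<otimes>\<^sub>2 (t \<otimes>\<^sub>2 r)"

context
  fixes C :: "('o, 'a, 'c, 'r) semi_monoidal_scheme" (structure)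
begin

definition cancellable :: "'o \<Rightarrow> bool" where
  "cancellable I \<longleftrightarrow> I \<in> Obj C \<and>
     fully_faithful_2functor C C
       (\<lambda>X. I \<otimes>\<^sub>0 X) (\<lambda>f. \<one>\<^sub>1 I \<otimes>\<^sub>1 f) (\<lambda>s. \<one>\<^sub>2 (\<one>\<^sub>1 I) \<otimes>\<^sub>2 s) \<and>
     fully_faithful_2functor C C
       (\<lambda>X. X \<otimes>\<^sub>0 I) (\<lambda>f. f \<otimes>\<^sub>1 \<one>\<^sub>1 I) (\<lambda>s. s \<otimes>\<^sub>2 \<one>\<^sub>2 (\<one>\<^sub>1 I))"

definition unit_object :: "'o \<Rightarrow> 'a \<Rightarrow> bool" where
  "unit_object I \<alpha> \<longleftrightarrow> cancellable I \<and> equi_arrow C \<alpha> (I \<otimes>\<^sub>0 I) I"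

definition unit_morphism :: "'o \<Rightarrow> 'a \<Rightarrow> 'o \<Rightarrow> 'a \<Rightarrow> 'a \<Rightarrow> 'c \<Rightarrow> bool" where
  "unit_morphism I \<alpha> J \<beta> u U \<longleftrightarrow> equi_arrow C u I J \<and>
     U \<in> hom2 C (\<alpha> \<sharp>\<^sub>1 u) (u \<otimes>\<^sub>1 u \<sharp>\<^sub>1 \<beta>) \<and> invertible C U"

text \<open>Since the associator of a unit does not depend on the auxiliary choices
  \<open>l\<close>, \<open>r\<close>, \<open>L\<close>, \<open>R\<close>, it is enough that \<open>A\<close> satisfies the defining equation for some choice.\<close>

definition canonical_associator :: "'o \<Rightarrow> 'a \<Rightarrow> 'c \<Rightarrow> bool" where
  "canonical_associator I \<alpha> A \<longleftrightarrow>
     A \<in> hom2 C (\<one>\<^sub>1 I \<otimes>\<^sub>1 \<alpha>) (\<alpha> \<otimes>\<^sub>1 \<one>\<^sub>1 I) \<and>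
     (\<exists>l r L R.
        equi_arrow C l (I \<otimes>\<^sub>0 I) I \<and>
        equi_arrow C r (I \<otimes>\<^sub>0 I) I \<and>
        L \<in> hom2 C (\<one>\<^sub>1 I \<otimes>\<^sub>1 l) (\<alpha> \<otimes>\<^sub>1 \<one>\<^sub>1 I) \<and> invertible C L \<and>
        R \<in> hom2 C (\<one>\<^sub>1 I \<otimes>\<^sub>1 \<alpha>) (r \<otimes>\<^sub>1 \<one>\<^sub>1 I) \<and> invertible C R \<and>
        (\<one>\<^sub>2 (\<one>\<^sub>1 I) \<otimes>\<^sub>2 inv_cell C L \<sharp>\<^sub>2 R) \<bullet> (inv_cell C R \<otimes>\<^sub>2 \<one>\<^sub>2 (\<one>\<^sub>1 I) \<sharp>\<^sub>2 L)
          = \<one>\<^sub>2 (\<one>\<^sub>1 I \<otimes>\<^sub>1 \<alpha> \<otimes>\<^sub>1 \<one>\<^sub>1 I) \<sharp>\<^sub>2 A)"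

text \<open>The condition on \<open>(f, F)\<close> to be a map of semi-monoids
  \<open>(X, \<alpha>, A) \<rightarrow> (Y, \<beta>, B)\<close>; the pentagon equations for \<open>A\<close> and \<open>B\<close> belong to the semi-monoids
  and are not part of the condition. Here \<open>A\<close> has type
  \<open>X\<alpha> \<sharp> \<alpha> \<Rightarrow> \<alpha>X \<sharp> \<alpha>\<close>.\<close>

definition semi_monoid_map ::
  "'o \<Rightarrow> 'a \<Rightarrow> 'c \<Rightarrow> 'o \<Rightarrow> 'a \<Rightarrow> 'c \<Rightarrow> 'a \<Rightarrow> 'c \<Rightarrow> bool" where
  "semi_monoid_map X \<alpha> A Y \<beta> B f F \<longleftrightarrow>
     f \<in> hom1 C X Y \<and>
     F \<in> hom2 C (\<alpha> \<sharp>\<^sub>1 f) (f \<otimes>\<^sub>1 f \<sharp>\<^sub>1 \<beta>) \<and> invertible C F \<and>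
     (A \<sharp>\<^sub>2 \<one>\<^sub>2 f) \<bullet> (\<one>\<^sub>2 (\<alpha> \<otimes>\<^sub>1 \<one>\<^sub>1 X) \<sharp>\<^sub>2 F) \<bullet> (F \<otimes>\<^sub>2 \<one>\<^sub>2 f \<sharp>\<^sub>2 \<one>\<^sub>2 \<beta>)
       = (\<one>\<^sub>2 (\<one>\<^sub>1 X \<otimes>\<^sub>1 \<alpha>) \<sharp>\<^sub>2 F) \<bullet> (\<one>\<^sub>2 f \<otimes>\<^sub>2 F \<sharp>\<^sub>2 \<one>\<^sub>2 \<beta>) \<bullet> (\<one>\<^sub>2 (f \<otimes>\<^sub>1 f \<otimes>\<^sub>1 f) \<sharp>\<^sub>2 B)"

end

end

theory Submission
  imports Defs
begin

text \<open>The equation says that \<open>A\<^sub>0\<close> and \<open>A\<^sub>1\<close> form a cylinder from the square \<open>uU\<close> to the square \<open>Uu\<close>.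
  Since \<open>u\<close> is an equi-arrow and \<open>I\<^sub>0\<close> is cancellable, tensoring with \<open>u\<close> is full on 2-cells, so there are
  squares \<open>W : \<lambda> \<sharp> u \<Rightarrow> uu \<sharp> \<lambda>'\<close> and \<open>V : \<rho> \<sharp> u \<Rightarrow> uu \<sharp> \<rho>'\<close> for which \<open>L\<close> is a cylinder from
  \<open>uW\<close> to \<open>Uu\<close> and \<open>R\<close> one from \<open>uU\<close> to \<open>Vu\<close>. Tensoring, inverting and pasting
  these cylinders yields two cylinders, composable because the square in the middle is \<open>V \<otimes> W\<close> for both,
  and their composite is \<open>I\<alpha>I \<sharp> A\<close>. Finally \<open>I\<alpha>I\<close> cancels, being an equi-arrow, and so does
  the invertible 2-cell \<open>uUu\<close>.\<close>

section \<open>Calculus of 2-cells and equi-arrows\<close>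

context two_category
begin

section \<open>Typing of arrows and 2-cells, and the 2-category laws as rewrite rules\<close>

lemma hom1_iff: "f \<in> hom1 C X Y \<longleftrightarrow> f \<in> Arr C \<and> Dom C f = X \<and> Cod C f = Y"
  by (simp add: hom1_def)

lemma hom2_iff: "s \<in> hom2 C f g \<longleftrightarrow> s \<in> Cell C \<and> Src C s = f \<and> Tgt C s = g"
  by (simp add: hom2_def)

lemma id1_simps [simp]:
  assumes "X \<in> Obj C"
  shows "\<one>\<^sub>1 X \<in> Arr C" "Dom C (\<one>\<^sub>1 X) = X" "Cod C (\<one>\<^sub>1 X) = X"
  using id1_hom[OF assms] by (auto simp: hom1_iff)

lemma comp1_simps [simp]:
  assumes "f \<in> Arr C" "g \<in> Arr C" "Cod C f = Dom C g"
  shows "f \<sharp>\<^sub>1 g \<in> Arr C" "Dom C (f \<sharp>\<^sub>1 g) = Dom C f" "Cod C (f \<sharp>\<^sub>1 g) = Cod C g"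
  using comp_hom[of f "Dom C f" "Cod C f" g "Cod C g"] assms by (auto simp: hom1_iff)

lemma comp1_id_simps [simp]:
  assumes "f \<in> Arr C"
  shows "Dom C f = X \<Longrightarrow> \<one>\<^sub>1 X \<sharp>\<^sub>1 f = f" "Cod C f = Y \<Longrightarrow> f \<sharp>\<^sub>1 \<one>\<^sub>1 Y = f"
  using comp_id_left comp_id_right assms by (auto simp: hom1_iff)

lemma comp1_assoc:
  assumes "f \<in> Arr C" "g \<in> Arr C" "h \<in> Arr C" "Cod C f = Dom C g" "Cod C g = Dom C h"
  shows "(f \<sharp>\<^sub>1 g) \<sharp>\<^sub>1 h = f \<sharp>\<^sub>1 (g \<sharp>\<^sub>1 h)"
  using assms by (intro comp_assoc) (auto simp: hom1_iff)

lemma id2_simps [simp]: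
  assumes "f \<in> Arr C"
  shows "\<one>\<^sub>2 f \<in> Cell C" "Src C (\<one>\<^sub>2 f) = f" "Tgt C (\<one>\<^sub>2 f) = f"
  using id2_hom[OF assms] by (auto simp: hom2_iff)

lemma cell_simps [simp]:
  assumes "s \<in> Cell C"
  shows "Src C s \<in> Arr C" "Tgt C s \<in> Arr C"
    "Dom C (Tgt C s) = Dom C (Src C s)" "Cod C (Tgt C s) = Cod C (Src C s)"
  using assms by (simp_all add: Src_Arr Tgt_Arr Dom_Src Cod_Src)

lemma vcomp_simps [simp]:
  assumes "s \<in> Cell C" "t \<in> Cell C" "Tgt C s = Src C t"
  shows "s \<bullet> t \<in> Cell C" "Src C (s \<bullet> t) = Src C s" "Tgt C (s \<bullet> t) = Tgt C t"
  using vcomp_hom[of s "Src C s" "Tgt C s" t "Tgt C t"] assms by (auto simp: hom2_iff)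

lemma vcomp_id_simps [simp]:
  assumes "s \<in> Cell C"
  shows "Src C s = f \<Longrightarrow> \<one>\<^sub>2 f \<bullet> s = s" "Tgt C s = g \<Longrightarrow> s \<bullet> \<one>\<^sub>2 g = s"
  using vcomp_id_left vcomp_id_right assms by (auto simp: hom2_iff)

lemma vcomp_assoc':
  assumes "s \<in> Cell C" "t \<in> Cell C" "r \<in> Cell C" "Tgt C s = Src C t" "Tgt C t = Src C r"
  shows "(s \<bullet> t) \<bullet> r = s \<bullet> (t \<bullet> r)"
  using assms by (intro vcomp_assoc) (auto simp: hom2_iff)

lemma hcomp_simps [simp]:
  assumes "s \<in> Cell C" "t \<in> Cell C" "Cod C (Src C s) = Dom C (Src C t)"
  shows "s \<sharp>\<^sub>2 t \<in> Cell C" "Src C (s \<sharp>\<^sub>2 t) = Src C s \<sharp>\<^sub>1 Src C t" "Tgt C (s \<sharp>\<^sub>2 t) = Tgt C s \<sharp>\<^sub>1 Tgt C t"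
  using hcomp_hom[of s "Src C s" "Tgt C s" t "Src C t" "Tgt C t"] assms by (auto simp: hom2_iff)

lemma hcomp_id1_simps [simp]:
  assumes "s \<in> Cell C"
  shows "Dom C (Src C s) = X \<Longrightarrow> \<one>\<^sub>2 (\<one>\<^sub>1 X) \<sharp>\<^sub>2 s = s"
    "Cod C (Src C s) = Y \<Longrightarrow> s \<sharp>\<^sub>2 \<one>\<^sub>2 (\<one>\<^sub>1 Y) = s"
  using assms hcomp_id_left hcomp_id_right by (auto simp: hom2_iff)

lemma hcomp_assoc':
  assumes "s \<in> Cell C" "t \<in> Cell C" "r \<in> Cell C"
    "Cod C (Src C s) = Dom C (Src C t)" "Cod C (Src C t) = Dom C (Src C r)"
  shows "(s \<sharp>\<^sub>2 t) \<sharp>\<^sub>2 r = s \<sharp>\<^sub>2 (t \<sharp>\<^sub>2 r)"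
  using assms hcomp_assoc[of s "Src C s" "Tgt C s" t "Src C t" "Tgt C t" r "Src C r" "Tgt C r"]
  by (simp add: hom2_iff)

lemma hcomp_id2_simp [simp]:
  assumes "f \<in> Arr C" "g \<in> Arr C" "Cod C f = Dom C g"
  shows "\<one>\<^sub>2 f \<sharp>\<^sub>2 \<one>\<^sub>2 g = \<one>\<^sub>2 (f \<sharp>\<^sub>1 g)"
  using assms by (intro hcomp_id2) (auto simp: hom1_iff)

lemma interchange':
  assumes "s \<in> Cell C" "s' \<in> Cell C" "t \<in> Cell C" "t' \<in> Cell C"
    "Tgt C s = Src C s'" "Tgt C t = Src C t'" "Cod C (Src C s) = Dom C (Src C t)"
  shows "(s \<sharp>\<^sub>2 t) \<bullet> (s' \<sharp>\<^sub>2 t') = (s \<bullet> s') \<sharp>\<^sub>2 (t \<bullet> t')"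
  using assms by (intro interchange) (auto simp: hom2_iff)

lemma whisker_vcomp:
  assumes "s \<in> Cell C" "t \<in> Cell C" "Tgt C s = Src C t" "f \<in> Arr C"
  shows "Cod C f = Dom C (Src C s) \<Longrightarrow> \<one>\<^sub>2 f \<sharp>\<^sub>2 (s \<bullet> t) = (\<one>\<^sub>2 f \<sharp>\<^sub>2 s) \<bullet> (\<one>\<^sub>2 f \<sharp>\<^sub>2 t)"
    "Cod C (Src C s) = Dom C f \<Longrightarrow> (s \<bullet> t) \<sharp>\<^sub>2 \<one>\<^sub>2 f = (s \<sharp>\<^sub>2 \<one>\<^sub>2 f) \<bullet> (t \<sharp>\<^sub>2 \<one>\<^sub>2 f)"
  using assms by (simp_all add: interchange')

text \<open>The interchange law with identities in two corners. Equating the two forms slides one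
  2-cell past the other, which is naturality as the proofs on equi-arrows use it.\<close>

lemma whisker_exchange:
  assumes "s \<in> Cell C" "t \<in> Cell C" "Cod C (Src C s) = Dom C (Src C t)"
  shows "(s \<sharp>\<^sub>2 \<one>\<^sub>2 (Src C t)) \<bullet> (\<one>\<^sub>2 (Tgt C s) \<sharp>\<^sub>2 t) = s \<sharp>\<^sub>2 t"
    "(\<one>\<^sub>2 (Src C s) \<sharp>\<^sub>2 t) \<bullet> (s \<sharp>\<^sub>2 \<one>\<^sub>2 (Tgt C t)) = s \<sharp>\<^sub>2 t"
  using assms by (simp_all add: interchange')


section \<open>Inverses of 2-cells and vertical cancellation\<close>

lemma inverse_cells_iff:
  "inverse_cells C s t \<longleftrightarrow> s \<in> Cell C \<and> t \<in> Cell C \<and> Src C t = Tgt C s \<and> Tgt C t = Src C s \<and>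
     s \<bullet> t = \<one>\<^sub>2 (Src C s) \<and> t \<bullet> s = \<one>\<^sub>2 (Tgt C s)"
  by (auto simp: inverse_cells_def hom2_iff)

lemma inverse_cells_sym: "inverse_cells C s t \<Longrightarrow> inverse_cells C t s"
  by (auto simp: inverse_cells_iff)

lemma inverse_cells_unique:
  assumes "inverse_cells C s t" "inverse_cells C s t'"
  shows "t = t'"
proof -
  have "t = t \<bullet> (s \<bullet> t')" using assms by (simp add: inverse_cells_iff)
  also have "\<dots> = (t \<bullet> s) \<bullet> t'"
    using assms by (subst vcomp_assoc') (auto simp: inverse_cells_iff)
  finally show ?thesis using assms by (simp add: inverse_cells_iff)
qed

lemma inv_cell:
  assumes "invertible C s"
  shows "inverse_cells C s (inv_cell C s)"
  using assms inverse_cells_unique unfolding invertible_def inv_cell_def by (metis theI)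

lemma inverse_cells_hcomp:
  assumes "inverse_cells C s t" "inverse_cells C s' t'" "Cod C (Src C s) = Dom C (Src C s')"
  shows "inverse_cells C (s \<sharp>\<^sub>2 s') (t \<sharp>\<^sub>2 t')"
proof -
  note ty = assms[unfolded inverse_cells_iff]
  have "Cod C (Src C t) = Dom C (Src C t')" using ty by (metis cell_simps(3,4))
  then show ?thesis using ty unfolding inverse_cells_iff by (simp add: interchange')
qed

lemma invertible_hcomp:
  assumes "invertible C s" "invertible C t" "Cod C (Src C s) = Dom C (Src C t)"
  shows "invertible C (s \<sharp>\<^sub>2 t)"
  using assms inverse_cells_hcomp unfolding invertible_def by blast

lemma invertible_id2: "f \<in> Arr C \<Longrightarrow> invertible C (\<one>\<^sub>2 f)"
  by (auto simp: invertible_def inverse_cells_iff intro!: exI[of _ "\<one>\<^sub>2 f"])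

lemma vcomp_cancel:
  assumes "invertible C r" "s \<in> Cell C" "t \<in> Cell C"
  shows "\<lbrakk>Tgt C s = Src C r; Tgt C t = Src C r; s \<bullet> r = t \<bullet> r\<rbrakk> \<Longrightarrow> s = t"
    and "\<lbrakk>Tgt C r = Src C s; Tgt C r = Src C t; r \<bullet> s = r \<bullet> t\<rbrakk> \<Longrightarrow> s = t"
proof -
  obtain r' where r': "r' \<in> Cell C" "Src C r' = Tgt C r" "Tgt C r' = Src C r"
    "r \<bullet> r' = \<one>\<^sub>2 (Src C r)" "r' \<bullet> r = \<one>\<^sub>2 (Tgt C r)" "r \<in> Cell C"
    using assms(1) by (auto simp: invertible_def inverse_cells_iff)
  have right: "(q \<bullet> r) \<bullet> r' = q" if "q \<in> Cell C" "Tgt C q = Src C r" for q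
    using vcomp_assoc'[of q r r'] r' that by simp
  have left: "r' \<bullet> (r \<bullet> q) = q" if "q \<in> Cell C" "Tgt C r = Src C q" for q
    using vcomp_assoc'[of r' r q] r' that by simp
  show "\<lbrakk>Tgt C s = Src C r; Tgt C t = Src C r; s \<bullet> r = t \<bullet> r\<rbrakk> \<Longrightarrow> s = t"
    using right[OF assms(2)] right[OF assms(3)] by metis
  show "\<lbrakk>Tgt C r = Src C s; Tgt C r = Src C t; r \<bullet> s = r \<bullet> t\<rbrakk> \<Longrightarrow> s = t"
    using left[OF assms(2)] left[OF assms(3)] by metis
qed


section \<open>Equi-arrows: whiskering by them is faithful and full\<close>

lemma equi_arrow_simps:
  assumes "equi_arrow C f X Y"
  shows "f \<in> Arr C" "Dom C f = X" "Cod C f = Y"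
  using assms by (auto simp: equi_arrow_def hom1_iff)

lemma equi_arrowE:
  assumes "equi_arrow C f X Y"
  obtains g s t where "g \<in> hom1 C Y X" "s \<in> hom2 C (f \<sharp>\<^sub>1 g) (\<one>\<^sub>1 X)" "invertible C s"
    "t \<in> hom2 C (g \<sharp>\<^sub>1 f) (\<one>\<^sub>1 Y)" "invertible C t"
  using assms by (auto simp: equi_arrow_def)

lemma equi_arrow_id1:
  assumes "X \<in> Obj C"
  shows "equi_arrow C (\<one>\<^sub>1 X) X X"
proof -
  have "\<one>\<^sub>2 (\<one>\<^sub>1 X) \<in> hom2 C (\<one>\<^sub>1 X \<sharp>\<^sub>1 \<one>\<^sub>1 X) (\<one>\<^sub>1 X)"
    using assms by (simp add: hom2_iff)
  moreover have "invertible C (\<one>\<^sub>2 (\<one>\<^sub>1 X))" using assms by (simp add: invertible_id2)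
  ultimately show ?thesis
    using id1_hom[OF assms] unfolding equi_arrow_def by blast
qed

text \<open>Sliding a 2-cell \<open>r\<close> past \<open>e\<close> recovers \<open>r\<close>, up to
  composition with whiskerings of \<open>e\<close>, from \<open>r\<close> whiskered by
  \<open>h\<close> and then by \<open>g\<close>; so \<open>r\<close> is determined by its whiskering
  by \<open>h\<close>. With \<open>g\<close> and \<open>e\<close> explicit, the lemma also applies
  with a pseudo-inverse in the role of \<open>h\<close>.\<close>

lemma hcomp_right_faithful:
  assumes h: "h \<in> Arr C" "g \<in> Arr C" "Cod C h = Dom C g"
    and e: "e \<in> hom2 C (h \<sharp>\<^sub>1 g) (\<one>\<^sub>1 (Dom C h))" "invertible C e"
    and s: "s \<in> hom2 C f f'" "t \<in> hom2 C f f'" "Cod C f = Dom C h"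
    and eq: "s \<sharp>\<^sub>2 \<one>\<^sub>2 h = t \<sharp>\<^sub>2 \<one>\<^sub>2 h"
  shows "s = t"
proof -
  have X: "Dom C h \<in> Obj C" "f \<in> Arr C" "f' \<in> Arr C"
    using Dom_Obj[OF h(1)] s by (auto simp: hom2_iff)
  have *: "(\<one>\<^sub>2 f \<sharp>\<^sub>2 e) \<bullet> r = ((r \<sharp>\<^sub>2 \<one>\<^sub>2 h) \<sharp>\<^sub>2 \<one>\<^sub>2 g) \<bullet> (\<one>\<^sub>2 f' \<sharp>\<^sub>2 e)" if "r \<in> hom2 C f f'" for r
    using whisker_exchange[of r e] that h e(1) s(3) X
    by (auto simp: hom2_iff hcomp_assoc')
  have eq': "(\<one>\<^sub>2 f \<sharp>\<^sub>2 e) \<bullet> s = (\<one>\<^sub>2 f \<sharp>\<^sub>2 e) \<bullet> t"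
    by (simp only: *[OF s(1)] *[OF s(2)] eq)
  have inv: "invertible C (\<one>\<^sub>2 f \<sharp>\<^sub>2 e)"
    using e s h by (intro invertible_hcomp invertible_id2) (auto simp: hom2_iff)
  show ?thesis
  proof (rule vcomp_cancel(2)[OF inv _ _ _ _ eq'])
  qed (use s e(1) h X in \<open>auto simp: hom2_iff\<close>)
qed

text \<open>Mirror image of \<open>hcomp_right_faithful\<close>: here \<open>e\<close> slides past
  \<open>r\<close> from the left.\<close>

lemma hcomp_left_faithful:
  assumes h: "h \<in> Arr C" "g \<in> Arr C" "Cod C g = Dom C h"
    and e: "e \<in> hom2 C (g \<sharp>\<^sub>1 h) (\<one>\<^sub>1 (Cod C h))" "invertible C e"
    and s: "s \<in> hom2 C f f'" "t \<in> hom2 C f f'" "Cod C h = Dom C f"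
    and eq: "\<one>\<^sub>2 h \<sharp>\<^sub>2 s = \<one>\<^sub>2 h \<sharp>\<^sub>2 t"
  shows "s = t"
proof -
  have X: "Cod C h \<in> Obj C" "f \<in> Arr C" "f' \<in> Arr C"
    using Cod_Obj[OF h(1)] s by (auto simp: hom2_iff)
  have *: "(e \<sharp>\<^sub>2 \<one>\<^sub>2 f) \<bullet> r = (\<one>\<^sub>2 g \<sharp>\<^sub>2 (\<one>\<^sub>2 h \<sharp>\<^sub>2 r)) \<bullet> (e \<sharp>\<^sub>2 \<one>\<^sub>2 f')" if "r \<in> hom2 C f f'" for r
    using whisker_exchange[of e r] that h e(1) s(3) X
    by (auto simp: hom2_iff hcomp_assoc'[symmetric])
  have eq': "(e \<sharp>\<^sub>2 \<one>\<^sub>2 f) \<bullet> s = (e \<sharp>\<^sub>2 \<one>\<^sub>2 f) \<bullet> t"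
    by (simp only: *[OF s(1)] *[OF s(2)] eq)
  have inv: "invertible C (e \<sharp>\<^sub>2 \<one>\<^sub>2 f)"
    using e s h by (intro invertible_hcomp invertible_id2) (auto simp: hom2_iff)
  show ?thesis
  proof (rule vcomp_cancel(2)[OF inv _ _ _ _ eq'])
  qed (use s e(1) h X in \<open>auto simp: hom2_iff\<close>)
qed

lemma equi_arrow_left_faithful:
  assumes "equi_arrow C h X Y" "s \<in> hom2 C f f'" "t \<in> hom2 C f f'" "Dom C f = Y"
    and "\<one>\<^sub>2 h \<sharp>\<^sub>2 s = \<one>\<^sub>2 h \<sharp>\<^sub>2 t"
  shows "s = t"
  using assms(1)
proof (rule equi_arrowE)
  fix g p q
  assume "g \<in> hom1 C Y X" "q \<in> hom2 C (g \<sharp>\<^sub>1 h) (\<one>\<^sub>1 Y)" "invertible C q"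
  with assms show ?thesis
    by (intro hcomp_left_faithful[of h g q s f f' t]) (auto simp: hom1_iff equi_arrow_simps)
qed

text \<open>The lift is the composite \<open>f\<close> to \<open>f # h # g\<close> to
  \<open>f' # h # g\<close> to \<open>f'\<close>, built from the inverse of \<open>s\<close>, from
  \<open>T\<close> whiskered by \<open>g\<close>, and from \<open>s\<close>. No triangle identity
  relates \<open>s\<close> and \<open>t\<close>, so the lift is not compared with \<open>T\<close>
  directly: the comparison is made after whiskering by \<open>g\<close>, which is faithful because
  of \<open>t\<close>.\<close>

lemma equi_arrow_right_full:
  assumes h: "equi_arrow C h X Y"
    and f: "f \<in> hom1 C W X" "f' \<in> hom1 C W X"
    and T: "T \<in> hom2 C (f \<sharp>\<^sub>1 h) (f' \<sharp>\<^sub>1 h)"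
  obtains T' where "T' \<in> hom2 C f f'" "T' \<sharp>\<^sub>2 \<one>\<^sub>2 h = T"
  using h
proof (rule equi_arrowE)
  fix g s t
  assume g: "g \<in> hom1 C Y X" and s: "s \<in> hom2 C (h \<sharp>\<^sub>1 g) (\<one>\<^sub>1 X)" "invertible C s"
    and t: "t \<in> hom2 C (g \<sharp>\<^sub>1 h) (\<one>\<^sub>1 Y)" "invertible C t"
  obtain s' where s': "inverse_cells C s s'" using s by (auto simp: invertible_def)
  have X: "X \<in> Obj C" using h equi_arrow_simps Dom_Obj by metis
  note ty = equi_arrow_simps[OF h] f[unfolded hom1_iff] T[unfolded hom2_iff] g[unfolded hom1_iff]
    s(1)[unfolded hom2_iff] X s'[unfolded inverse_cells_iff]
  define T' where "T' = (\<one>\<^sub>2 f \<sharp>\<^sub>2 s') \<bullet> ((T \<sharp>\<^sub>2 \<one>\<^sub>2 g) \<bullet> (\<one>\<^sub>2 f' \<sharp>\<^sub>2 s))"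
  have T': "T' \<in> hom2 C f f'"
    unfolding T'_def using ty by (simp add: hom2_iff comp1_assoc)
  \<comment> \<open>Sliding \<open>T'\<close> past \<open>s\<close> brings the whiskering by
    \<open>s\<close> in front of \<open>T'\<close>, where it cancels the inverse \<open>s'\<close>
    with which \<open>T'\<close> starts.\<close>
  have "((T' \<sharp>\<^sub>2 \<one>\<^sub>2 h) \<sharp>\<^sub>2 \<one>\<^sub>2 g) \<bullet> (\<one>\<^sub>2 f' \<sharp>\<^sub>2 s) = (\<one>\<^sub>2 f \<sharp>\<^sub>2 s) \<bullet> T'"
    using whisker_exchange[of T' s] ty T' by (auto simp: hom2_iff hcomp_assoc')
  also have "\<dots> = ((\<one>\<^sub>2 f \<sharp>\<^sub>2 s) \<bullet> (\<one>\<^sub>2 f \<sharp>\<^sub>2 s')) \<bullet> ((T \<sharp>\<^sub>2 \<one>\<^sub>2 g) \<bullet> (\<one>\<^sub>2 f' \<sharp>\<^sub>2 s))"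
    unfolding T'_def using ty by (subst vcomp_assoc') (auto simp: comp1_assoc)
  also have "\<dots> = (T \<sharp>\<^sub>2 \<one>\<^sub>2 g) \<bullet> (\<one>\<^sub>2 f' \<sharp>\<^sub>2 s)"
    using ty by (simp add: interchange' comp1_assoc)
  finally have *: "((T' \<sharp>\<^sub>2 \<one>\<^sub>2 h) \<sharp>\<^sub>2 \<one>\<^sub>2 g) \<bullet> (\<one>\<^sub>2 f' \<sharp>\<^sub>2 s) = (T \<sharp>\<^sub>2 \<one>\<^sub>2 g) \<bullet> (\<one>\<^sub>2 f' \<sharp>\<^sub>2 s)" .
  have "invertible C (\<one>\<^sub>2 f' \<sharp>\<^sub>2 s)"
    using ty s by (intro invertible_hcomp invertible_id2) auto
  then have "(T' \<sharp>\<^sub>2 \<one>\<^sub>2 h) \<sharp>\<^sub>2 \<one>\<^sub>2 g = T \<sharp>\<^sub>2 \<one>\<^sub>2 g"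
    by (rule vcomp_cancel(1)[OF _ _ _ _ _ *]) (use ty T' in \<open>simp_all add: hom2_iff comp1_assoc\<close>)
  \<comment> \<open>Faithfulness with the roles exchanged: the whiskering is by \<open>g\<close>,
    and \<open>h\<close> is its inverse through \<open>t\<close>.\<close>
  then have "T' \<sharp>\<^sub>2 \<one>\<^sub>2 h = T"
    by (rule hcomp_right_faithful[rotated -1, of _ g _ h t "f \<sharp>\<^sub>1 h" "f' \<sharp>\<^sub>1 h"])
      (use ty t T' in \<open>simp_all add: hom2_iff\<close>)
  with T' show ?thesis by (rule that)
qed


section \<open>Squares and cylinders\<close>

text \<open>A square is a 2-cell \<open>f \<sharp> w \<Rightarrow> v \<sharp> f'\<close>, seen as a morphism from \<open>f\<close> to \<open>f'\<close> along \<open>v\<close> and \<open>w\<close>.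
  A cylinder is a commuting pair \<open>a : f \<Rightarrow> g\<close>, \<open>a' : f' \<Rightarrow> g'\<close> between two squares over the same
  \<open>v\<close> and \<open>w\<close>.\<close>

definition square :: "'a \<Rightarrow> 'a \<Rightarrow> 'a \<Rightarrow> 'a \<Rightarrow> 'c \<Rightarrow> bool" where
  "square f v w f' \<sigma> \<longleftrightarrow> f \<in> Arr C \<and> v \<in> Arr C \<and> w \<in> Arr C \<and> f' \<in> Arr C \<and>
     Dom C v = Dom C f \<and> Dom C w = Cod C f \<and> Dom C f' = Cod C v \<and> Cod C f' = Cod C w \<and>
     \<sigma> \<in> hom2 C (f \<sharp>\<^sub>1 w) (v \<sharp>\<^sub>1 f')"

definition cylinder :: "'a \<Rightarrow> 'a \<Rightarrow> 'c \<Rightarrow> 'c \<Rightarrow> 'c \<Rightarrow> 'c \<Rightarrow> bool" where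
  "cylinder v w a \<sigma> \<tau> a' \<longleftrightarrow> a \<in> Cell C \<and> a' \<in> Cell C \<and>
     square (Src C a) v w (Src C a') \<sigma> \<and> square (Tgt C a) v w (Tgt C a') \<tau> \<and>
     (a \<sharp>\<^sub>2 \<one>\<^sub>2 w) \<bullet> \<tau> = \<sigma> \<bullet> (\<one>\<^sub>2 v \<sharp>\<^sub>2 a')"

text \<open>Juxtaposes two squares along a common side. The outer arrows \<open>f\<close> and
  \<open>h'\<close> are arguments because a 2-cell records only its composite source and target, not
  their factors.\<close>

definition paste :: "'a \<Rightarrow> 'a \<Rightarrow> 'c \<Rightarrow> 'c \<Rightarrow> 'c" where
  "paste f h' \<sigma> \<tau> = (\<one>\<^sub>2 f \<sharp>\<^sub>2 \<tau>) \<bullet> (\<sigma> \<sharp>\<^sub>2 \<one>\<^sub>2 h')"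

lemma cylinderD:
  assumes "cylinder v w a \<sigma> \<tau> a'"
  shows "a \<in> Cell C" "a' \<in> Cell C" "square (Src C a) v w (Src C a') \<sigma>"
    "square (Tgt C a) v w (Tgt C a') \<tau>" "(a \<sharp>\<^sub>2 \<one>\<^sub>2 w) \<bullet> \<tau> = \<sigma> \<bullet> (\<one>\<^sub>2 v \<sharp>\<^sub>2 a')"
  using assms by (simp_all add: cylinder_def)

lemma square_paste:
  assumes "square f u v f' \<sigma>" "square h v w h' \<tau>"
  shows "square (f \<sharp>\<^sub>1 h) u w (f' \<sharp>\<^sub>1 h') (paste f h' \<sigma> \<tau>)"
  using assms by (simp add: square_def paste_def hom2_iff comp1_assoc)

lemma cylinder_id:
  assumes "square f v w f' \<sigma>"
  shows "cylinder v w (\<one>\<^sub>2 f) \<sigma> \<sigma> (\<one>\<^sub>2 f')"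
  using assms by (simp add: square_def cylinder_def hom2_iff)

lemma cylinder_vcomp:
  assumes "cylinder v w a \<rho> \<sigma> a'" "cylinder v w b \<sigma> \<tau> b'" "Tgt C a = Src C b" "Tgt C a' = Src C b'"
  shows "cylinder v w (a \<bullet> b) \<rho> \<tau> (a' \<bullet> b')"
proof -
  note ty = assms(1,2)[unfolded cylinder_def square_def hom2_iff] assms(3,4)
  have "((a \<bullet> b) \<sharp>\<^sub>2 \<one>\<^sub>2 w) \<bullet> \<tau> = (a \<sharp>\<^sub>2 \<one>\<^sub>2 w) \<bullet> ((b \<sharp>\<^sub>2 \<one>\<^sub>2 w) \<bullet> \<tau>)"
    using ty by (simp add: whisker_vcomp vcomp_assoc')
  also have "\<dots> = ((a \<sharp>\<^sub>2 \<one>\<^sub>2 w) \<bullet> \<sigma>) \<bullet> (\<one>\<^sub>2 v \<sharp>\<^sub>2 b')"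
    using ty by (metis (no_types, lifting) vcomp_assoc' hcomp_simps id2_simps)
  also have "\<dots> = \<rho> \<bullet> (\<one>\<^sub>2 v \<sharp>\<^sub>2 (a' \<bullet> b'))"
    using ty by (simp add: whisker_vcomp vcomp_assoc')
  finally show ?thesis using ty by (simp add: cylinder_def square_def hom2_iff)
qed

lemma cylinder_inverse:
  assumes "cylinder v w a \<sigma> \<tau> a'" "inverse_cells C a b" "inverse_cells C a' b'"
  shows "cylinder v w b \<tau> \<sigma> b'"
proof -
  have sq: "square (Src C a) v w (Src C a') \<sigma>" "square (Tgt C a) v w (Tgt C a') \<tau>"
    and eq: "(a \<sharp>\<^sub>2 \<one>\<^sub>2 w) \<bullet> \<tau> = \<sigma> \<bullet> (\<one>\<^sub>2 v \<sharp>\<^sub>2 a')"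
    using assms(1) by (simp_all add: cylinder_def)
  note ty = sq[unfolded square_def hom2_iff] assms(2,3)[unfolded inverse_cells_iff]
  \<comment> \<open>Insert \<open>a' \<bullet> b' = 1\<close> behind \<sigma>, use the given
    commutation to turn \<open>a'\<close> into \<open>a\<close>, and cancel \<open>a\<close> against
    \<open>b\<close>.\<close>
  have "(b \<sharp>\<^sub>2 \<one>\<^sub>2 w) \<bullet> \<sigma> = (b \<sharp>\<^sub>2 \<one>\<^sub>2 w) \<bullet> (\<sigma> \<bullet> ((\<one>\<^sub>2 v \<sharp>\<^sub>2 a') \<bullet> (\<one>\<^sub>2 v \<sharp>\<^sub>2 b')))"
    using ty by (simp add: interchange')
  also have "\<dots> = (b \<sharp>\<^sub>2 \<one>\<^sub>2 w) \<bullet> ((\<sigma> \<bullet> (\<one>\<^sub>2 v \<sharp>\<^sub>2 a')) \<bullet> (\<one>\<^sub>2 v \<sharp>\<^sub>2 b'))"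
    using vcomp_assoc'[of \<sigma> "\<one>\<^sub>2 v \<sharp>\<^sub>2 a'" "\<one>\<^sub>2 v \<sharp>\<^sub>2 b'"] ty by simp
  also have "\<dots> = (b \<sharp>\<^sub>2 \<one>\<^sub>2 w) \<bullet> (((a \<sharp>\<^sub>2 \<one>\<^sub>2 w) \<bullet> \<tau>) \<bullet> (\<one>\<^sub>2 v \<sharp>\<^sub>2 b'))"
    by (simp only: eq)
  also have "\<dots> = ((b \<sharp>\<^sub>2 \<one>\<^sub>2 w) \<bullet> (a \<sharp>\<^sub>2 \<one>\<^sub>2 w)) \<bullet> (\<tau> \<bullet> (\<one>\<^sub>2 v \<sharp>\<^sub>2 b'))"
    using vcomp_assoc'[of "a \<sharp>\<^sub>2 \<one>\<^sub>2 w" \<tau> "\<one>\<^sub>2 v \<sharp>\<^sub>2 b'"]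
      vcomp_assoc'[of "b \<sharp>\<^sub>2 \<one>\<^sub>2 w" "a \<sharp>\<^sub>2 \<one>\<^sub>2 w" "\<tau> \<bullet> (\<one>\<^sub>2 v \<sharp>\<^sub>2 b')"] ty
    by simp
  also have "\<dots> = \<tau> \<bullet> (\<one>\<^sub>2 v \<sharp>\<^sub>2 b')"
    using ty by (simp add: interchange')
  finally show ?thesis using ty by (simp add: cylinder_def square_def hom2_iff)
qed

text \<open>The commutation equation can be solved for its source square when \<open>a'\<close> is
  invertible: take \<open>a # w\<close>, then \<tau>, then \<open>v\<close> whiskered with the
  inverse of \<open>a'\<close>. This supplies the unknown squares from which a tensor factor
  \<open>u\<close> is later removed.\<close>

lemma cylinder_lift:
  assumes sq: "square (Tgt C a) v w (Tgt C a') \<tau>"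
    and a: "a \<in> Cell C" "a' \<in> Cell C" "invertible C a'"
  obtains \<sigma> where "cylinder v w a \<sigma> \<tau> a'"
proof -
  obtain b where b: "inverse_cells C a' b" using a by (auto simp: invertible_def)
  note ty = sq[unfolded square_def hom2_iff] a b[unfolded inverse_cells_iff]
  let ?\<tau> = "(a \<sharp>\<^sub>2 \<one>\<^sub>2 w) \<bullet> \<tau>"
  have "(?\<tau> \<bullet> (\<one>\<^sub>2 v \<sharp>\<^sub>2 b)) \<bullet> (\<one>\<^sub>2 v \<sharp>\<^sub>2 a') = ?\<tau> \<bullet> (\<one>\<^sub>2 v \<sharp>\<^sub>2 (b \<bullet> a'))"
    using ty vcomp_assoc'[of ?\<tau> "\<one>\<^sub>2 v \<sharp>\<^sub>2 b" "\<one>\<^sub>2 v \<sharp>\<^sub>2 a'"] by (simp add: interchange')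
  then have "cylinder v w a (?\<tau> \<bullet> (\<one>\<^sub>2 v \<sharp>\<^sub>2 b)) \<tau> a'"
    using ty unfolding cylinder_def square_def hom2_iff by simp
  then show ?thesis by (rule that)
qed

text \<open>Interchange lets the two commutations be applied one after the other: first
  \<open>b\<close> crosses \<tau>', then \<open>a\<close> crosses \<sigma>'.\<close>

lemma cylinder_paste:
  assumes "cylinder u v a \<sigma> \<sigma>' a'" "cylinder v w b \<tau> \<tau>' b'"
  shows "cylinder u w (a \<sharp>\<^sub>2 b) (paste (Src C a) (Src C b') \<sigma> \<tau>) (paste (Tgt C a) (Tgt C b') \<sigma>' \<tau>')
    (a' \<sharp>\<^sub>2 b')"
proof -
  note ty = assms[unfolded cylinder_def square_def hom2_iff]
  have "((a \<sharp>\<^sub>2 b) \<sharp>\<^sub>2 \<one>\<^sub>2 w) \<bullet> ((\<one>\<^sub>2 (Tgt C a) \<sharp>\<^sub>2 \<tau>') \<bullet> (\<sigma>' \<sharp>\<^sub>2 \<one>\<^sub>2 (Tgt C b')))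
    = (a \<sharp>\<^sub>2 ((b \<sharp>\<^sub>2 \<one>\<^sub>2 w) \<bullet> \<tau>')) \<bullet> (\<sigma>' \<sharp>\<^sub>2 \<one>\<^sub>2 (Tgt C b'))"
    using ty by (subst vcomp_assoc'[symmetric]) (auto simp: hcomp_assoc' interchange' comp1_assoc)
  also have "\<dots> = (a \<sharp>\<^sub>2 (\<tau> \<bullet> (\<one>\<^sub>2 v \<sharp>\<^sub>2 b'))) \<bullet> (\<sigma>' \<sharp>\<^sub>2 \<one>\<^sub>2 (Tgt C b'))"
    using ty by simp
  also have "\<dots> = ((\<one>\<^sub>2 (Src C a) \<sharp>\<^sub>2 \<tau>) \<bullet> ((a \<sharp>\<^sub>2 \<one>\<^sub>2 v) \<sharp>\<^sub>2 b')) \<bullet> (\<sigma>' \<sharp>\<^sub>2 \<one>\<^sub>2 (Tgt C b'))"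
    using ty by (simp add: hcomp_assoc' interchange')
  also have "\<dots> = (\<one>\<^sub>2 (Src C a) \<sharp>\<^sub>2 \<tau>) \<bullet> (((a \<sharp>\<^sub>2 \<one>\<^sub>2 v) \<bullet> \<sigma>') \<sharp>\<^sub>2 b')"
    using ty by (subst vcomp_assoc') (auto simp: comp1_assoc interchange')
  also have "\<dots> = (\<one>\<^sub>2 (Src C a) \<sharp>\<^sub>2 \<tau>) \<bullet> ((\<sigma> \<bullet> (\<one>\<^sub>2 u \<sharp>\<^sub>2 a')) \<sharp>\<^sub>2 b')"
    using ty by simp
  also have "\<dots> = (\<one>\<^sub>2 (Src C a) \<sharp>\<^sub>2 \<tau>) \<bullet> ((\<sigma> \<sharp>\<^sub>2 \<one>\<^sub>2 (Src C b')) \<bullet> (\<one>\<^sub>2 u \<sharp>\<^sub>2 (a' \<sharp>\<^sub>2 b')))"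
    using ty by (simp add: hcomp_assoc'[symmetric] interchange')
  also have "\<dots> = ((\<one>\<^sub>2 (Src C a) \<sharp>\<^sub>2 \<tau>) \<bullet> (\<sigma> \<sharp>\<^sub>2 \<one>\<^sub>2 (Src C b'))) \<bullet> (\<one>\<^sub>2 u \<sharp>\<^sub>2 (a' \<sharp>\<^sub>2 b'))"
    using ty by (subst vcomp_assoc') (auto simp: comp1_assoc)
  finally show ?thesis
    using ty unfolding cylinder_def by (simp add: square_paste square_def paste_def hom2_iff comp1_assoc)
qed

text \<open>A converse to pasting with the identity cylinder on \<sigma>. The pasted equation is the
  wanted one whiskered by \<open>e\<close> and followed by \<open>\<sigma> # h'\<close>; the latter
  cancels as an invertible 2-cell, the former because \<open>e\<close> is an equi-arrow.\<close>

lemma cylinder_cancel: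
  assumes cyl: "cylinder u w (\<one>\<^sub>2 e \<sharp>\<^sub>2 a) (paste e h \<sigma> \<tau>) (paste e h' \<sigma> \<tau>') (\<one>\<^sub>2 e' \<sharp>\<^sub>2 a')"
    and a: "a \<in> Cell C" "a' \<in> Cell C" "Src C a' = h" "Tgt C a' = h'"
    and sq: "square e u v e' \<sigma>" "square (Src C a) v w h \<tau>" "square (Tgt C a) v w h' \<tau>'"
    and e: "equi_arrow C e X Y" and \<sigma>: "invertible C \<sigma>"
  shows "cylinder v w a \<tau> \<tau>' a'"
proof -
  note ty = sq[unfolded square_def hom2_iff] a
  have "(\<one>\<^sub>2 e \<sharp>\<^sub>2 ((a \<sharp>\<^sub>2 \<one>\<^sub>2 w) \<bullet> \<tau>')) \<bullet> (\<sigma> \<sharp>\<^sub>2 \<one>\<^sub>2 h')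
    = ((\<one>\<^sub>2 e \<sharp>\<^sub>2 a) \<sharp>\<^sub>2 \<one>\<^sub>2 w) \<bullet> paste e h' \<sigma> \<tau>'"
    unfolding paste_def using ty
    by (auto simp: comp1_assoc whisker_vcomp vcomp_assoc' hcomp_assoc')
  also have "\<dots> = paste e h \<sigma> \<tau> \<bullet> (\<one>\<^sub>2 u \<sharp>\<^sub>2 (\<one>\<^sub>2 e' \<sharp>\<^sub>2 a'))"
    using cyl by (simp add: cylinder_def)
  also have "\<dots> = (\<one>\<^sub>2 e \<sharp>\<^sub>2 \<tau>) \<bullet> (\<sigma> \<sharp>\<^sub>2 a')"
    unfolding paste_def using ty
    by (auto simp: comp1_assoc vcomp_assoc' hcomp_assoc'[symmetric] interchange')
  also have "\<sigma> \<sharp>\<^sub>2 a' = (\<one>\<^sub>2 e \<sharp>\<^sub>2 (\<one>\<^sub>2 v \<sharp>\<^sub>2 a')) \<bullet> (\<sigma> \<sharp>\<^sub>2 \<one>\<^sub>2 h')"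
    using ty by (auto simp: hcomp_assoc'[symmetric] interchange')
  also have "(\<one>\<^sub>2 e \<sharp>\<^sub>2 \<tau>) \<bullet> ((\<one>\<^sub>2 e \<sharp>\<^sub>2 (\<one>\<^sub>2 v \<sharp>\<^sub>2 a')) \<bullet> (\<sigma> \<sharp>\<^sub>2 \<one>\<^sub>2 h'))
    = (\<one>\<^sub>2 e \<sharp>\<^sub>2 (\<tau> \<bullet> (\<one>\<^sub>2 v \<sharp>\<^sub>2 a'))) \<bullet> (\<sigma> \<sharp>\<^sub>2 \<one>\<^sub>2 h')"
    using ty by (auto simp: comp1_assoc whisker_vcomp vcomp_assoc')
  finally have eq: "(\<one>\<^sub>2 e \<sharp>\<^sub>2 ((a \<sharp>\<^sub>2 \<one>\<^sub>2 w) \<bullet> \<tau>')) \<bullet> (\<sigma> \<sharp>\<^sub>2 \<one>\<^sub>2 h')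
    = (\<one>\<^sub>2 e \<sharp>\<^sub>2 (\<tau> \<bullet> (\<one>\<^sub>2 v \<sharp>\<^sub>2 a'))) \<bullet> (\<sigma> \<sharp>\<^sub>2 \<one>\<^sub>2 h')" .
  have inv: "invertible C (\<sigma> \<sharp>\<^sub>2 \<one>\<^sub>2 h')"
    using ty \<sigma> by (intro invertible_hcomp invertible_id2) auto
  have eq': "\<one>\<^sub>2 e \<sharp>\<^sub>2 ((a \<sharp>\<^sub>2 \<one>\<^sub>2 w) \<bullet> \<tau>') = \<one>\<^sub>2 e \<sharp>\<^sub>2 (\<tau> \<bullet> (\<one>\<^sub>2 v \<sharp>\<^sub>2 a'))"
    by (rule vcomp_cancel(1)[OF inv _ _ _ _ eq]) (use ty in \<open>simp_all add: comp1_assoc\<close>)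
  have "(a \<sharp>\<^sub>2 \<one>\<^sub>2 w) \<bullet> \<tau>' = \<tau> \<bullet> (\<one>\<^sub>2 v \<sharp>\<^sub>2 a')"
    by (rule equi_arrow_left_faithful[OF e _ _ _ eq', of "Src C a \<sharp>\<^sub>1 w" "v \<sharp>\<^sub>1 h'"])
      (use ty equi_arrow_simps[OF e] in \<open>simp_all add: hom2_iff\<close>)
  then show ?thesis using a sq by (simp add: cylinder_def)
qed

end


section \<open>Fullness of equivalences\<close>

text \<open>The preimage is \<open>G1 m\<close> transported along \<eta> at \<open>x\<close> and the
  inverse \<open>h\<close> of \<eta> at \<open>y\<close>. Naturality of \<eta> only shows that
  \<open>F1 n\<close> and \<open>m\<close> have the same image under \<open>G1\<close>, so
  faithfulness of \<open>G1\<close> is needed as well.\<close>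

lemma equivalence_of_categories_full:
  assumes eq: "equivalence_of_categories D E F0 F1"
    and x: "x \<in> ob D" "y \<in> ob D" and m: "m \<in> homs E (F0 x) (F0 y)"
  obtains n where "n \<in> homs D x y" "F1 n = m"
proof -
  obtain G0 G1 \<eta> \<epsilon> where F: "cat_functor D E F0 F1" and G: "cat_functor E D G0 G1"
    and \<eta>: "natural_iso D D id id (G0 \<circ> F0) (G1 \<circ> F1) \<eta>"
    and \<epsilon>: "natural_iso E E (F0 \<circ> G0) (F1 \<circ> G1) id id \<epsilon>"
    using eq unfolding equivalence_of_categories_def by blast
  interpret F: cat_functor D E F0 F1 by fact
  interpret G: cat_functor E D G0 G1 by fact
  have \<eta>h: "\<eta> z \<in> homs D z (G0 (F0 z))" if "z \<in> ob D" for z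
    using \<eta> that by (simp add: natural_iso_def isomorphism_def)
  have \<eta>n: "cmp D n (\<eta> z') = cmp D (\<eta> z) (G1 (F1 n))" if "n \<in> homs D z z'" for n z z'
    using \<eta> that by (simp add: natural_iso_def)
  \<comment> \<open>Naturality of \<epsilon> expresses \<open>\<epsilon> (F0 x)\<close> followed by
    \<open>p\<close> through \<open>G1 p\<close>, and \<open>\<epsilon> (F0 x)\<close> has the left
    inverse \<open>e\<close>.\<close>
  have G_faithful: "p = q"
    if p: "p \<in> homs E (F0 x) (F0 y)" and q: "q \<in> homs E (F0 x) (F0 y)" and pq: "G1 p = G1 q" for p q
  proof -
    have "F0 x \<in> ob E" using F.F0_ob x by blast
    then obtain e where \<epsilon>x: "\<epsilon> (F0 x) \<in> homs E (F0 (G0 (F0 x))) (F0 x)"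
      and e: "e \<in> homs E (F0 x) (F0 (G0 (F0 x)))" "cmp E e (\<epsilon> (F0 x)) = idn E (F0 x)"
      using \<epsilon> by (auto simp: natural_iso_def isomorphism_def)
    have "cmp E (\<epsilon> (F0 x)) p = cmp E (\<epsilon> (F0 x)) q"
      using \<epsilon> p q pq unfolding natural_iso_def by (metis comp_apply id_apply)
    then have "cmp E (cmp E e (\<epsilon> (F0 x))) p = cmp E (cmp E e (\<epsilon> (F0 x))) q"
      using F.target.cmp_assoc[OF e(1) \<epsilon>x p] F.target.cmp_assoc[OF e(1) \<epsilon>x q] by simp
    then show ?thesis using e(2) F.target.idn_left p q by simp
  qed
  obtain h where h: "h \<in> homs D (G0 (F0 y)) y" "cmp D (\<eta> y) h = idn D y"
    "cmp D h (\<eta> y) = idn D (G0 (F0 y))"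
    using \<eta> x by (auto simp: natural_iso_def isomorphism_def)
  obtain k where k: "k \<in> homs D (G0 (F0 x)) x" "cmp D k (\<eta> x) = idn D (G0 (F0 x))"
    using \<eta> x by (auto simp: natural_iso_def isomorphism_def)
  have Gm: "G1 m \<in> homs D (G0 (F0 x)) (G0 (F0 y))" by (rule G.F1_homs[OF m])
  have \<eta>m: "cmp D (\<eta> x) (G1 m) \<in> homs D x (G0 (F0 y))"
    by (rule F.source.cmp_homs[OF \<eta>h[OF x(1)] Gm])
  define n where "n = cmp D (cmp D (\<eta> x) (G1 m)) h"
  have n: "n \<in> homs D x y" unfolding n_def by (rule F.source.cmp_homs[OF \<eta>m h(1)])
  have "cmp D n (\<eta> y) = cmp D (cmp D (\<eta> x) (G1 m)) (cmp D h (\<eta> y))"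
    unfolding n_def by (rule F.source.cmp_assoc[OF \<eta>m h(1) \<eta>h[OF x(2)]])
  also have "\<dots> = cmp D (\<eta> x) (G1 m)"
    using F.source.idn_right[OF \<eta>m] h(3) by simp
  finally have "cmp D (\<eta> x) (G1 (F1 n)) = cmp D (\<eta> x) (G1 m)" using \<eta>n[OF n] by simp
  \<comment> \<open>The inverse \<open>k\<close> of \<eta> at \<open>x\<close> cancels \<eta> on the
    left.\<close>
  then have "cmp D (cmp D k (\<eta> x)) (G1 (F1 n)) = cmp D (cmp D k (\<eta> x)) (G1 m)"
    using F.source.cmp_assoc[OF k(1) \<eta>h[OF x(1)] Gm]
      F.source.cmp_assoc[OF k(1) \<eta>h[OF x(1)] G.F1_homs[OF F.F1_homs[OF n]]] by simp
  then have "G1 (F1 n) = G1 m"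
    using k(2) F.source.idn_left[OF Gm] F.source.idn_left[OF G.F1_homs[OF F.F1_homs[OF n]]] by simp
  then have "F1 n = m" by (rule G_faithful[OF F.F1_homs[OF n] m])
  with n show ?thesis by (rule that)
qed

lemma fully_faithful_2functor_full:
  assumes "fully_faithful_2functor C D F0 F1 F2" "f \<in> hom1 C X Y" "g \<in> hom1 C X Y"
    and t: "t \<in> hom2 D (F1 f) (F1 g)"
  obtains s where "s \<in> hom2 C f g" "F2 s = t"
proof -
  interpret fully_faithful_2functor C D F0 F1 F2 by fact
  have X: "X \<in> Obj C" "Y \<in> Obj C"
    using assms(2) source.Dom_Obj source.Cod_Obj by (auto simp: hom1_def)
  have "t \<in> homs (hom_cat D (F0 X) (F0 Y)) (F1 f) (F1 g)"
    using t F1_hom[OF assms(2)] by (auto simp: homs_def hom_cat_def hom2_def)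
  then obtain s where "s \<in> homs (hom_cat C X Y) f g" "F2 s = t"
    using equivalence_of_categories_full[OF hom_equivalence[OF X], of f g t] assms(2,3)
    by (auto simp: hom_cat_def)
  then show ?thesis using that by (auto simp: homs_def hom_cat_def hom2_def)
qed


section \<open>Tensoring squares and cylinders\<close>

context semi_monoidal_2category
begin

interpretation tensor: strict_2functor "prod_2cat C C" C
  "\<lambda>(X, Y). X \<otimes>\<^sub>0 Y" "\<lambda>(f, g). f \<otimes>\<^sub>1 g" "\<lambda>(s, t). s \<otimes>\<^sub>2 t"
  by (rule tensor_2functor)

section \<open>The tensor 2-functor unpacked from pairs\<close>

lemma tensor0_Obj [simp]: "X \<in> Obj C \<Longrightarrow> Y \<in> Obj C \<Longrightarrow> X \<otimes>\<^sub>0 Y \<in> Obj C"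
  using tensor.F0_Obj[of "(X, Y)"] by (simp add: prod_2cat_def)

lemma tensor1_simps [simp]:
  assumes "f \<in> Arr C" "g \<in> Arr C"
  shows "f \<otimes>\<^sub>1 g \<in> Arr C" "Dom C (f \<otimes>\<^sub>1 g) = Dom C f \<otimes>\<^sub>0 Dom C g" "Cod C (f \<otimes>\<^sub>1 g) = Cod C f \<otimes>\<^sub>0 Cod C g"
  using tensor.F1_hom[of "(f, g)" "(Dom C f, Dom C g)" "(Cod C f, Cod C g)"] assms
  by (auto simp: prod_2cat_def hom1_def)

lemma tensor2_simps [simp]:
  assumes "s \<in> Cell C" "t \<in> Cell C"
  shows "s \<otimes>\<^sub>2 t \<in> Cell C" "Src C (s \<otimes>\<^sub>2 t) = Src C s \<otimes>\<^sub>1 Src C t" "Tgt C (s \<otimes>\<^sub>2 t) = Tgt C s \<otimes>\<^sub>1 Tgt C t"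
  using tensor.F2_hom[of "(s, t)" "(Src C s, Src C t)" "(Tgt C s, Tgt C t)"] assms
  by (auto simp: prod_2cat_def hom2_def)

lemma tensor1_id1 [simp]:
  "X \<in> Obj C \<Longrightarrow> Y \<in> Obj C \<Longrightarrow> \<one>\<^sub>1 X \<otimes>\<^sub>1 \<one>\<^sub>1 Y = \<one>\<^sub>1 (X \<otimes>\<^sub>0 Y)"
  using tensor.F1_id1[of "(X, Y)"] by (simp add: prod_2cat_def)

lemma tensor2_id2 [simp]:
  "f \<in> Arr C \<Longrightarrow> g \<in> Arr C \<Longrightarrow> \<one>\<^sub>2 f \<otimes>\<^sub>2 \<one>\<^sub>2 g = \<one>\<^sub>2 (f \<otimes>\<^sub>1 g)"
  using tensor.F2_id2[of "(f, g)"] by (simp add: prod_2cat_def)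

lemma tensor1_comp1:
  assumes "f \<in> Arr C" "f' \<in> Arr C" "g \<in> Arr C" "g' \<in> Arr C" "Cod C f = Dom C g" "Cod C f' = Dom C g'"
  shows "(f \<otimes>\<^sub>1 f') \<sharp>\<^sub>1 (g \<otimes>\<^sub>1 g') = (f \<sharp>\<^sub>1 g) \<otimes>\<^sub>1 (f' \<sharp>\<^sub>1 g')"
  using tensor.F1_comp[of "(f, f')" "(Dom C f, Dom C f')" "(Cod C f, Cod C f')" "(g, g')"
    "(Cod C g, Cod C g')"] assms
  by (simp add: prod_2cat_def hom1_def)

lemma tensor2_vcomp:
  assumes "s \<in> Cell C" "s' \<in> Cell C" "t \<in> Cell C" "t' \<in> Cell C" "Tgt C s = Src C t" "Tgt C s' = Src C t'"
  shows "(s \<otimes>\<^sub>2 s') \<bullet> (t \<otimes>\<^sub>2 t') = (s \<bullet> t) \<otimes>\<^sub>2 (s' \<bullet> t')"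
  using tensor.F2_vcomp[of "(s, s')" "(Src C s, Src C s')" "(Tgt C s, Tgt C s')" "(t, t')"
    "(Tgt C t, Tgt C t')"] assms
  by (simp add: prod_2cat_def hom2_def)

lemma tensor2_hcomp:
  assumes "s \<in> Cell C" "s' \<in> Cell C" "t \<in> Cell C" "t' \<in> Cell C"
    "Cod C (Src C s) = Dom C (Src C t)" "Cod C (Src C s') = Dom C (Src C t')"
  shows "(s \<otimes>\<^sub>2 s') \<sharp>\<^sub>2 (t \<otimes>\<^sub>2 t') = (s \<sharp>\<^sub>2 t) \<otimes>\<^sub>2 (s' \<sharp>\<^sub>2 t')"
  using tensor.F2_hcomp[of "(s, s')" "(Src C s, Src C s')" "(Tgt C s, Tgt C s')" "(t, t')"
    "(Src C t, Src C t')" "(Tgt C t, Tgt C t')"] assms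
  by (simp add: prod_2cat_def hom2_def)

section \<open>Tensor products of invertible 2-cells and of equi-arrows\<close>

lemma inverse_cells_tensor2:
  assumes "inverse_cells C s t" "inverse_cells C s' t'"
  shows "inverse_cells C (s \<otimes>\<^sub>2 s') (t \<otimes>\<^sub>2 t')"
  using assms unfolding inverse_cells_iff by (simp add: tensor2_vcomp)

lemma invertible_tensor2:
  assumes "invertible C s" "invertible C t"
  shows "invertible C (s \<otimes>\<^sub>2 t)"
  using assms inverse_cells_tensor2 unfolding invertible_def by blast

lemma equi_arrow_tensor1:
  assumes "equi_arrow C f X Y" "equi_arrow C f' X' Y'"
  shows "equi_arrow C (f \<otimes>\<^sub>1 f') (X \<otimes>\<^sub>0 X') (Y \<otimes>\<^sub>0 Y')"
proof -
  note f = equi_arrow_simps[OF assms(1)] and f' = equi_arrow_simps[OF assms(2)]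
  obtain g s t where g: "g \<in> hom1 C Y X" "s \<in> hom2 C (f \<sharp>\<^sub>1 g) (\<one>\<^sub>1 X)" "invertible C s"
    "t \<in> hom2 C (g \<sharp>\<^sub>1 f) (\<one>\<^sub>1 Y)" "invertible C t"
    by (rule equi_arrowE[OF assms(1)])
  obtain g' s' t' where g': "g' \<in> hom1 C Y' X'" "s' \<in> hom2 C (f' \<sharp>\<^sub>1 g') (\<one>\<^sub>1 X')" "invertible C s'"
    "t' \<in> hom2 C (g' \<sharp>\<^sub>1 f') (\<one>\<^sub>1 Y')" "invertible C t'"
    by (rule equi_arrowE[OF assms(2)])
  have X: "X \<in> Obj C" "Y \<in> Obj C" "X' \<in> Obj C" "Y' \<in> Obj C"
    using Dom_Obj[OF f(1)] Dom_Obj[OF f'(1)] Cod_Obj[OF f(1)] Cod_Obj[OF f'(1)] f f' by simp_all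
  have "s \<otimes>\<^sub>2 s' \<in> hom2 C ((f \<otimes>\<^sub>1 f') \<sharp>\<^sub>1 (g \<otimes>\<^sub>1 g')) (\<one>\<^sub>1 (X \<otimes>\<^sub>0 X'))"
    "t \<otimes>\<^sub>2 t' \<in> hom2 C ((g \<otimes>\<^sub>1 g') \<sharp>\<^sub>1 (f \<otimes>\<^sub>1 f')) (\<one>\<^sub>1 (Y \<otimes>\<^sub>0 Y'))"
    "f \<otimes>\<^sub>1 f' \<in> hom1 C (X \<otimes>\<^sub>0 X') (Y \<otimes>\<^sub>0 Y')" "g \<otimes>\<^sub>1 g' \<in> hom1 C (Y \<otimes>\<^sub>0 Y') (X \<otimes>\<^sub>0 X')"
    using f f' g g' X by (auto simp: hom1_iff hom2_iff tensor1_comp1)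
  then show ?thesis
    using invertible_tensor2 g g' unfolding equi_arrow_def by blast
qed

text \<open>The identity 2-cell of \<open>u\<close> is a square from the identity of
  \<open>X\<close> to the identity of \<open>Y\<close> along \<open>u\<close> and \<open>u\<close>.
  The result is the tensor product of its identity cylinder with the given one, and commutes because
  the tensor preserves both compositions.\<close>

lemma cylinder_tensor_left:
  assumes cyl: "cylinder v w a \<sigma> \<tau> a'" and u: "u \<in> hom1 C X Y"
  shows "cylinder (u \<otimes>\<^sub>1 v) (u \<otimes>\<^sub>1 w) (\<one>\<^sub>2 (\<one>\<^sub>1 X) \<otimes>\<^sub>2 a) (\<one>\<^sub>2 u \<otimes>\<^sub>2 \<sigma>) (\<one>\<^sub>2 u \<otimes>\<^sub>2 \<tau>) (\<one>\<^sub>2 (\<one>\<^sub>1 Y) \<otimes>\<^sub>2 a')"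
proof -
  note ty = cyl[unfolded cylinder_def square_def hom2_iff] u[unfolded hom1_iff]
  have X: "X \<in> Obj C" "Y \<in> Obj C" using u Dom_Obj Cod_Obj by (auto simp: hom1_iff)
  show ?thesis
    using ty X unfolding cylinder_def square_def hom2_iff
    by (simp add: tensor1_comp1 tensor2_hcomp tensor2_vcomp flip: tensor2_id2)
qed

lemma cylinder_tensor_right:
  assumes cyl: "cylinder v w a \<sigma> \<tau> a'" and u: "u \<in> hom1 C X Y"
  shows "cylinder (v \<otimes>\<^sub>1 u) (w \<otimes>\<^sub>1 u) (a \<otimes>\<^sub>2 \<one>\<^sub>2 (\<one>\<^sub>1 X)) (\<sigma> \<otimes>\<^sub>2 \<one>\<^sub>2 u) (\<tau> \<otimes>\<^sub>2 \<one>\<^sub>2 u) (a' \<otimes>\<^sub>2 \<one>\<^sub>2 (\<one>\<^sub>1 Y))"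
proof -
  note ty = cyl[unfolded cylinder_def square_def hom2_iff] u[unfolded hom1_iff]
  have X: "X \<in> Obj C" "Y \<in> Obj C" using u Dom_Obj Cod_Obj by (auto simp: hom1_iff)
  show ?thesis
    using ty X unfolding cylinder_def square_def hom2_iff
    by (simp add: tensor1_comp1 tensor2_hcomp tensor2_vcomp flip: tensor2_id2)
qed

text \<open>The arrow \<open>u \<otimes> f\<close> factors as \<open>X \<otimes> f\<close> followed
  by \<open>u \<otimes> W\<close>. Whiskering by the equi-arrow \<open>u \<otimes> W\<close> is
  full, and tensoring with \<open>X\<close> is full by cancellability, so \<open>T\<close> lifts in
  two stages.\<close>

lemma tensor_left_full:
  assumes u: "equi_arrow C u X Y" and X: "cancellable C X"
    and f: "f \<in> hom1 C Z W" "g \<in> hom1 C Z W"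
    and T: "T \<in> hom2 C (u \<otimes>\<^sub>1 f) (u \<otimes>\<^sub>1 g)"
  obtains s where "s \<in> hom2 C f g" "\<one>\<^sub>2 u \<otimes>\<^sub>2 s = T"
proof -
  note ty = equi_arrow_simps[OF u] f[unfolded hom1_iff]
  have ob: "X \<in> Obj C" "W \<in> Obj C" using ty Dom_Obj Cod_Obj by auto
  have full: "fully_faithful_2functor C C (\<lambda>X'. X \<otimes>\<^sub>0 X') (\<lambda>f. \<one>\<^sub>1 X \<otimes>\<^sub>1 f) (\<lambda>s. \<one>\<^sub>2 (\<one>\<^sub>1 X) \<otimes>\<^sub>2 s)"
    using X by (simp add: cancellable_def)
  have eq: "u \<otimes>\<^sub>1 f = (\<one>\<^sub>1 X \<otimes>\<^sub>1 f) \<sharp>\<^sub>1 (u \<otimes>\<^sub>1 \<one>\<^sub>1 W)" "u \<otimes>\<^sub>1 g = (\<one>\<^sub>1 X \<otimes>\<^sub>1 g) \<sharp>\<^sub>1 (u \<otimes>\<^sub>1 \<one>\<^sub>1 W)"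
    using ty ob by (simp_all add: tensor1_comp1)
  have e: "equi_arrow C (u \<otimes>\<^sub>1 \<one>\<^sub>1 W) (X \<otimes>\<^sub>0 W) (Y \<otimes>\<^sub>0 W)"
    by (intro equi_arrow_tensor1 u equi_arrow_id1 ob)
  have "\<one>\<^sub>1 X \<otimes>\<^sub>1 f \<in> hom1 C (X \<otimes>\<^sub>0 Z) (X \<otimes>\<^sub>0 W)" "\<one>\<^sub>1 X \<otimes>\<^sub>1 g \<in> hom1 C (X \<otimes>\<^sub>0 Z) (X \<otimes>\<^sub>0 W)"
    using ty ob by (simp_all add: hom1_iff)
  from equi_arrow_right_full[OF e this T[unfolded eq]]
  obtain T' where T': "T' \<in> hom2 C (\<one>\<^sub>1 X \<otimes>\<^sub>1 f) (\<one>\<^sub>1 X \<otimes>\<^sub>1 g)" "T' \<sharp>\<^sub>2 \<one>\<^sub>2 (u \<otimes>\<^sub>1 \<one>\<^sub>1 W) = T" .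
  from fully_faithful_2functor_full[OF full f T'(1)]
  obtain s where s: "s \<in> hom2 C f g" "\<one>\<^sub>2 (\<one>\<^sub>1 X) \<otimes>\<^sub>2 s = T'" .
  have "\<one>\<^sub>2 u \<otimes>\<^sub>2 s = (\<one>\<^sub>2 (\<one>\<^sub>1 X) \<otimes>\<^sub>2 s) \<sharp>\<^sub>2 (\<one>\<^sub>2 u \<otimes>\<^sub>2 \<one>\<^sub>2 (\<one>\<^sub>1 W))"
    using ty ob s(1) by (simp add: tensor2_hcomp hom2_iff del: tensor2_id2)
  then have "\<one>\<^sub>2 u \<otimes>\<^sub>2 s = T" using T' s ty ob by simp
  with s(1) show ?thesis by (rule that)
qed

text \<open>Mirror image of \<open>tensor_left_full\<close>, with \<open>f \<otimes> u\<close>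
  factored as \<open>f \<otimes> X\<close> followed by \<open>W \<otimes> u\<close>.\<close>

lemma tensor_right_full:
  assumes u: "equi_arrow C u X Y" and X: "cancellable C X"
    and f: "f \<in> hom1 C Z W" "g \<in> hom1 C Z W"
    and T: "T \<in> hom2 C (f \<otimes>\<^sub>1 u) (g \<otimes>\<^sub>1 u)"
  obtains s where "s \<in> hom2 C f g" "s \<otimes>\<^sub>2 \<one>\<^sub>2 u = T"
proof -
  note ty = equi_arrow_simps[OF u] f[unfolded hom1_iff]
  have ob: "X \<in> Obj C" "W \<in> Obj C" using ty Dom_Obj Cod_Obj by auto
  have full: "fully_faithful_2functor C C (\<lambda>X'. X' \<otimes>\<^sub>0 X) (\<lambda>f. f \<otimes>\<^sub>1 \<one>\<^sub>1 X) (\<lambda>s. s \<otimes>\<^sub>2 \<one>\<^sub>2 (\<one>\<^sub>1 X))"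
    using X by (simp add: cancellable_def)
  have eq: "f \<otimes>\<^sub>1 u = (f \<otimes>\<^sub>1 \<one>\<^sub>1 X) \<sharp>\<^sub>1 (\<one>\<^sub>1 W \<otimes>\<^sub>1 u)" "g \<otimes>\<^sub>1 u = (g \<otimes>\<^sub>1 \<one>\<^sub>1 X) \<sharp>\<^sub>1 (\<one>\<^sub>1 W \<otimes>\<^sub>1 u)"
    using ty ob by (simp_all add: tensor1_comp1)
  have e: "equi_arrow C (\<one>\<^sub>1 W \<otimes>\<^sub>1 u) (W \<otimes>\<^sub>0 X) (W \<otimes>\<^sub>0 Y)"
    by (intro equi_arrow_tensor1 u equi_arrow_id1 ob)
  have "f \<otimes>\<^sub>1 \<one>\<^sub>1 X \<in> hom1 C (Z \<otimes>\<^sub>0 X) (W \<otimes>\<^sub>0 X)" "g \<otimes>\<^sub>1 \<one>\<^sub>1 X \<in> hom1 C (Z \<otimes>\<^sub>0 X) (W \<otimes>\<^sub>0 X)"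
    using ty ob by (simp_all add: hom1_iff)
  from equi_arrow_right_full[OF e this T[unfolded eq]]
  obtain T' where T': "T' \<in> hom2 C (f \<otimes>\<^sub>1 \<one>\<^sub>1 X) (g \<otimes>\<^sub>1 \<one>\<^sub>1 X)" "T' \<sharp>\<^sub>2 \<one>\<^sub>2 (\<one>\<^sub>1 W \<otimes>\<^sub>1 u) = T" .
  from fully_faithful_2functor_full[OF full f T'(1)]
  obtain s where s: "s \<in> hom2 C f g" "s \<otimes>\<^sub>2 \<one>\<^sub>2 (\<one>\<^sub>1 X) = T'" .
  have "s \<otimes>\<^sub>2 \<one>\<^sub>2 u = (s \<otimes>\<^sub>2 \<one>\<^sub>2 (\<one>\<^sub>1 X)) \<sharp>\<^sub>2 (\<one>\<^sub>2 (\<one>\<^sub>1 W) \<otimes>\<^sub>2 \<one>\<^sub>2 u)"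
    using ty ob s(1) by (simp add: tensor2_hcomp hom2_iff del: tensor2_id2)
  then have "s \<otimes>\<^sub>2 \<one>\<^sub>2 u = T" using T' s ty ob by simp
  with s(1) show ?thesis by (rule that)
qed

text \<open>Interchange between the tensor factors allows either square to be performed first. That
  both orders give the same 2-cell is what makes the two large cylinders below share a face.\<close>

lemma paste_tensor:
  assumes "square f v w f' \<sigma>" "square g p q g' \<tau>"
  shows "paste (\<one>\<^sub>1 (Dom C f) \<otimes>\<^sub>1 g) (f' \<otimes>\<^sub>1 \<one>\<^sub>1 (Cod C g')) (\<one>\<^sub>2 v \<otimes>\<^sub>2 \<tau>) (\<sigma> \<otimes>\<^sub>2 \<one>\<^sub>2 q) = \<sigma> \<otimes>\<^sub>2 \<tau>"
    and "paste (f \<otimes>\<^sub>1 \<one>\<^sub>1 (Dom C g)) (\<one>\<^sub>1 (Cod C f') \<otimes>\<^sub>1 g') (\<sigma> \<otimes>\<^sub>2 \<one>\<^sub>2 p) (\<one>\<^sub>2 w \<otimes>\<^sub>2 \<tau>) = \<sigma> \<otimes>\<^sub>2 \<tau>"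
proof -
  note ty = assms[unfolded square_def hom2_iff]
  have ob: "Dom C f \<in> Obj C" "Cod C f' \<in> Obj C" "Dom C g \<in> Obj C" "Cod C g' \<in> Obj C"
    using ty Dom_Obj Cod_Obj by blast+
  show "paste (\<one>\<^sub>1 (Dom C f) \<otimes>\<^sub>1 g) (f' \<otimes>\<^sub>1 \<one>\<^sub>1 (Cod C g')) (\<one>\<^sub>2 v \<otimes>\<^sub>2 \<tau>) (\<sigma> \<otimes>\<^sub>2 \<one>\<^sub>2 q) = \<sigma> \<otimes>\<^sub>2 \<tau>"
    "paste (f \<otimes>\<^sub>1 \<one>\<^sub>1 (Dom C g)) (\<one>\<^sub>1 (Cod C f') \<otimes>\<^sub>1 g') (\<sigma> \<otimes>\<^sub>2 \<one>\<^sub>2 p) (\<one>\<^sub>2 w \<otimes>\<^sub>2 \<tau>) = \<sigma> \<otimes>\<^sub>2 \<tau>"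
    unfolding paste_def using ty ob
    by (simp_all add: tensor2_hcomp tensor2_vcomp flip: tensor2_id2)
qed

lemma associator_cylinder:
  assumes u: "equi_arrow C u I J" and I: "cancellable C I"
    and \<alpha>: "equi_arrow C \<alpha> (I \<otimes>\<^sub>0 I) I" and \<beta>: "\<beta> \<in> hom1 C (J \<otimes>\<^sub>0 J) J"
    and U: "U \<in> hom2 C (\<alpha> \<sharp>\<^sub>1 u) (u \<otimes>\<^sub>1 u \<sharp>\<^sub>1 \<beta>)" "invertible C U"
    and A: "canonical_associator C I \<alpha> A" and B: "canonical_associator C J \<beta> B"
  shows "cylinder (u \<otimes>\<^sub>1 (u \<otimes>\<^sub>1 u)) (u \<otimes>\<^sub>1 u) A (\<one>\<^sub>2 u \<otimes>\<^sub>2 U) (U \<otimes>\<^sub>2 \<one>\<^sub>2 u) B"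
proof -
  let ?i = "\<one>\<^sub>1 I" and ?j = "\<one>\<^sub>1 J" and ?uu = "u \<otimes>\<^sub>1 u" and ?uuu = "u \<otimes>\<^sub>1 (u \<otimes>\<^sub>1 u)"
  obtain l r L R where
    A_hom: "A \<in> hom2 C (?i \<otimes>\<^sub>1 \<alpha>) (\<alpha> \<otimes>\<^sub>1 ?i)" and
    l: "equi_arrow C l (I \<otimes>\<^sub>0 I) I" and r: "equi_arrow C r (I \<otimes>\<^sub>0 I) I" and
    L: "L \<in> hom2 C (?i \<otimes>\<^sub>1 l) (\<alpha> \<otimes>\<^sub>1 ?i)" "invertible C L" and
    R: "R \<in> hom2 C (?i \<otimes>\<^sub>1 \<alpha>) (r \<otimes>\<^sub>1 ?i)" "invertible C R" and
    A_eq: "(\<one>\<^sub>2 ?i \<otimes>\<^sub>2 inv_cell C L \<sharp>\<^sub>2 R) \<bullet> (inv_cell C R \<otimes>\<^sub>2 \<one>\<^sub>2 ?i \<sharp>\<^sub>2 L)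
      = \<one>\<^sub>2 (?i \<otimes>\<^sub>1 \<alpha> \<otimes>\<^sub>1 ?i) \<sharp>\<^sub>2 A"
    using A unfolding canonical_associator_def by blast
  obtain l' r' L' R' where
    B_hom: "B \<in> hom2 C (?j \<otimes>\<^sub>1 \<beta>) (\<beta> \<otimes>\<^sub>1 ?j)" and
    l': "equi_arrow C l' (J \<otimes>\<^sub>0 J) J" and r': "equi_arrow C r' (J \<otimes>\<^sub>0 J) J" and
    L': "L' \<in> hom2 C (?j \<otimes>\<^sub>1 l') (\<beta> \<otimes>\<^sub>1 ?j)" "invertible C L'" and
    R': "R' \<in> hom2 C (?j \<otimes>\<^sub>1 \<beta>) (r' \<otimes>\<^sub>1 ?j)" "invertible C R'" and
    B_eq: "(\<one>\<^sub>2 ?j \<otimes>\<^sub>2 inv_cell C L' \<sharp>\<^sub>2 R') \<bullet> (inv_cell C R' \<otimes>\<^sub>2 \<one>\<^sub>2 ?j \<sharp>\<^sub>2 L')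
      = \<one>\<^sub>2 (?j \<otimes>\<^sub>1 \<beta> \<otimes>\<^sub>1 ?j) \<sharp>\<^sub>2 B"
    using B unfolding canonical_associator_def by blast
  have u1: "u \<in> hom1 C I J" using equi_arrow_simps[OF u] by (simp add: hom1_iff)
  have ob: "I \<in> Obj C" "J \<in> Obj C" using u1 Dom_Obj Cod_Obj by (auto simp: hom1_iff)
  note arr = equi_arrow_simps[OF u] equi_arrow_simps[OF \<alpha>] \<beta>[unfolded hom1_iff]
    equi_arrow_simps[OF l] equi_arrow_simps[OF r] equi_arrow_simps[OF l'] equi_arrow_simps[OF r'] ob
  note cell = U(1)[unfolded hom2_iff] L(1)[unfolded hom2_iff] R(1)[unfolded hom2_iff]
    L'(1)[unfolded hom2_iff] R'(1)[unfolded hom2_iff] A_hom[unfolded hom2_iff] B_hom[unfolded hom2_iff]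
  note inv = inv_cell[OF L(2)] inv_cell[OF R(2)] inv_cell[OF L'(2)] inv_cell[OF R'(2)]
  note icell = inv[unfolded inverse_cells_iff]

  \<comment> \<open>The target square over \<open>L\<close> is \<open>Uu\<close>; solving for the
    source square gives a 2-cell \<sigma> between arrows of the form \<open>u \<otimes> _\<close>,
    and fullness removes the factor \<open>u\<close>. The resulting \<open>Wl\<close> is the square
    \<open>W\<close> of the idea.\<close>
  have "square (Tgt C L) ?uuu ?uu (Tgt C L') (U \<otimes>\<^sub>2 \<one>\<^sub>2 u)"
    unfolding square_def hom2_iff using arr cell
    by (simp add: tensor0_assoc tensor1_comp1 flip: tensor1_assoc)
  then obtain \<sigma> where \<sigma>: "cylinder ?uuu ?uu L \<sigma> (U \<otimes>\<^sub>2 \<one>\<^sub>2 u) L'"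
    by (rule cylinder_lift) (use cell L' in auto)
  then have "\<sigma> \<in> hom2 C (u \<otimes>\<^sub>1 (l \<sharp>\<^sub>1 u)) (u \<otimes>\<^sub>1 (?uu \<sharp>\<^sub>1 l'))"
    using arr cell unfolding cylinder_def square_def hom2_iff by (simp add: tensor1_comp1)
  then obtain Wl where Wl: "Wl \<in> hom2 C (l \<sharp>\<^sub>1 u) (?uu \<sharp>\<^sub>1 l')" "\<one>\<^sub>2 u \<otimes>\<^sub>2 Wl = \<sigma>"
    by (rule tensor_left_full[OF u I, rotated 2,
        where Z = "I \<otimes>\<^sub>0 I" and W = J and f = "l \<sharp>\<^sub>1 u" and g = "?uu \<sharp>\<^sub>1 l'"])
      (use arr in \<open>simp_all add: hom1_iff\<close>)
  have C1: "cylinder ?uuu ?uu L (\<one>\<^sub>2 u \<otimes>\<^sub>2 Wl) (U \<otimes>\<^sub>2 \<one>\<^sub>2 u) L'"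
    using \<sigma> Wl by simp

  \<comment> \<open>Over \<open>R\<close> the unknown square is the target, so the lift is made over
    the inverse of \<open>R\<close>, whose target square is \<open>uU\<close>, and the cylinder is
    inverted afterwards. The resulting \<open>Wr\<close> is the square \<open>V\<close> of the
    idea.\<close>
  have "square (Tgt C (inv_cell C R)) ?uuu ?uu (Tgt C (inv_cell C R')) (\<one>\<^sub>2 u \<otimes>\<^sub>2 U)"
    unfolding square_def hom2_iff using arr cell icell
    by (simp add: tensor0_assoc tensor1_comp1)
  then obtain \<rho> where \<rho>: "cylinder ?uuu ?uu (inv_cell C R) \<rho> (\<one>\<^sub>2 u \<otimes>\<^sub>2 U) (inv_cell C R')"
  proof (rule cylinder_lift)
    show "invertible C (inv_cell C R')"
      using inverse_cells_sym[OF inv(4)] by (auto simp: invertible_def)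
  qed (use icell in auto)
  then have "\<rho> \<in> hom2 C ((r \<sharp>\<^sub>1 u) \<otimes>\<^sub>1 u) ((?uu \<sharp>\<^sub>1 r') \<otimes>\<^sub>1 u)"
    using arr cell icell unfolding cylinder_def square_def hom2_iff
    by (simp add: tensor1_comp1 flip: tensor1_assoc)
  then obtain Wr where Wr: "Wr \<in> hom2 C (r \<sharp>\<^sub>1 u) (?uu \<sharp>\<^sub>1 r')" "Wr \<otimes>\<^sub>2 \<one>\<^sub>2 u = \<rho>"
    by (rule tensor_right_full[OF u I, rotated 2,
        where Z = "I \<otimes>\<^sub>0 I" and W = J and f = "r \<sharp>\<^sub>1 u" and g = "?uu \<sharp>\<^sub>1 r'"])
      (use arr in \<open>simp_all add: hom1_iff\<close>)
  have C2': "cylinder ?uuu ?uu (inv_cell C R) (Wr \<otimes>\<^sub>2 \<one>\<^sub>2 u) (\<one>\<^sub>2 u \<otimes>\<^sub>2 U) (inv_cell C R')"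
    using \<rho> Wr by simp
  have C2: "cylinder ?uuu ?uu R (\<one>\<^sub>2 u \<otimes>\<^sub>2 U) (Wr \<otimes>\<^sub>2 \<one>\<^sub>2 u) R'"
    by (rule cylinder_inverse[OF C2' inv(2,4)[THEN inverse_cells_sym]])
  \<comment> \<open>\<open>C3\<close> pasted with \<open>C2\<close> lies over the first factor of
    the equation defining the associator, and \<open>C4\<close> pasted with \<open>C1\<close> over
    the second.\<close>
  have C3: "cylinder (u \<otimes>\<^sub>1 ?uuu) ?uuu (\<one>\<^sub>2 ?i \<otimes>\<^sub>2 inv_cell C L) (\<one>\<^sub>2 u \<otimes>\<^sub>2 (U \<otimes>\<^sub>2 \<one>\<^sub>2 u))
      (\<one>\<^sub>2 u \<otimes>\<^sub>2 (\<one>\<^sub>2 u \<otimes>\<^sub>2 Wl)) (\<one>\<^sub>2 ?j \<otimes>\<^sub>2 inv_cell C L')"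
    by (rule cylinder_tensor_left[OF cylinder_inverse[OF C1 inv(1,3)] u1])
  have C4: "cylinder (u \<otimes>\<^sub>1 ?uuu) ?uuu (inv_cell C R \<otimes>\<^sub>2 \<one>\<^sub>2 ?i) (Wr \<otimes>\<^sub>2 \<one>\<^sub>2 ?uu)
      (\<one>\<^sub>2 u \<otimes>\<^sub>2 (U \<otimes>\<^sub>2 \<one>\<^sub>2 u)) (inv_cell C R' \<otimes>\<^sub>2 \<one>\<^sub>2 ?j)"
    using cylinder_tensor_right[OF C2' u1] arr cell icell Wr(1)[unfolded hom2_iff]
    by (simp add: tensor1_assoc tensor2_assoc)
  have sqWl: "square l ?uu u l' Wl" and sqWr: "square r ?uu u r' Wr"
    using arr Wl(1) Wr(1) by (simp_all add: square_def)
  \<comment> \<open>Both sides are \<open>Wr \<otimes> Wl\<close>: after rebracketing they are the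
    two decompositions in \<open>paste_tensor\<close>.\<close>
  have mid: "paste (Tgt C (\<one>\<^sub>2 ?i \<otimes>\<^sub>2 inv_cell C L)) (Tgt C R') (\<one>\<^sub>2 u \<otimes>\<^sub>2 (\<one>\<^sub>2 u \<otimes>\<^sub>2 Wl)) (Wr \<otimes>\<^sub>2 \<one>\<^sub>2 u)
    = paste (Src C (inv_cell C R \<otimes>\<^sub>2 \<one>\<^sub>2 ?i)) (Src C L') (Wr \<otimes>\<^sub>2 \<one>\<^sub>2 ?uu) (\<one>\<^sub>2 u \<otimes>\<^sub>2 Wl)"
    using paste_tensor[OF sqWr sqWl] arr cell icell Wl(1)[unfolded hom2_iff]
    by (simp add: tensor1_assoc tensor2_assoc flip: tensor1_id1 tensor2_id2)
  \<comment> \<open>The identity \<open>II\<lambda> # \<rho>I = \<rho>II # I\<lambda>\<close>, by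
    which the two factors of the defining equation are composable.\<close>
  have exchange: "(\<one>\<^sub>1 K \<otimes>\<^sub>1 (\<one>\<^sub>1 K \<otimes>\<^sub>1 p)) \<sharp>\<^sub>1 (q \<otimes>\<^sub>1 \<one>\<^sub>1 K) = ((q \<otimes>\<^sub>1 \<one>\<^sub>1 K) \<otimes>\<^sub>1 \<one>\<^sub>1 K) \<sharp>\<^sub>1 (\<one>\<^sub>1 K \<otimes>\<^sub>1 p)"
    if "equi_arrow C p (K \<otimes>\<^sub>0 K) K" "equi_arrow C q (K \<otimes>\<^sub>0 K) K" "K \<in> Obj C" for K p q
    using equi_arrow_simps[OF that(1)] equi_arrow_simps[OF that(2)] that(3)
      tensor1_assoc[of "\<one>\<^sub>1 K" "\<one>\<^sub>1 K" p, symmetric] tensor1_assoc[of q "\<one>\<^sub>1 K" "\<one>\<^sub>1 K"]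
    by (simp add: tensor1_comp1 tensor0_assoc)
  \<comment> \<open>Stacking the two pasted cylinders gives the left-hand sides of
    \<open>A_eq\<close> and \<open>B_eq\<close>, which rewrite to the whiskered associators. Both
    outer faces now begin with the same square \<open>uUu\<close>.\<close>
  have C5: "cylinder (u \<otimes>\<^sub>1 ?uuu) ?uu (\<one>\<^sub>2 (?i \<otimes>\<^sub>1 (\<alpha> \<otimes>\<^sub>1 ?i)) \<sharp>\<^sub>2 A)
     (paste (?i \<otimes>\<^sub>1 (\<alpha> \<otimes>\<^sub>1 ?i)) (?j \<otimes>\<^sub>1 \<beta>) (\<one>\<^sub>2 u \<otimes>\<^sub>2 (U \<otimes>\<^sub>2 \<one>\<^sub>2 u)) (\<one>\<^sub>2 u \<otimes>\<^sub>2 U))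
     (paste (?i \<otimes>\<^sub>1 (\<alpha> \<otimes>\<^sub>1 ?i)) (\<beta> \<otimes>\<^sub>1 ?j) (\<one>\<^sub>2 u \<otimes>\<^sub>2 (U \<otimes>\<^sub>2 \<one>\<^sub>2 u)) (U \<otimes>\<^sub>2 \<one>\<^sub>2 u))
     (\<one>\<^sub>2 (?j \<otimes>\<^sub>1 (\<beta> \<otimes>\<^sub>1 ?j)) \<sharp>\<^sub>2 B)"
    using cylinder_vcomp[OF cylinder_paste[OF C3 C2, unfolded mid] cylinder_paste[OF C4 C1],
        unfolded A_eq B_eq] arr cell icell
      exchange[OF l r ob(1)] exchange[OF l' r' ob(2)]
    by (simp add: tensor1_assoc tensor0_assoc)
  have "invertible C (\<one>\<^sub>2 u \<otimes>\<^sub>2 (U \<otimes>\<^sub>2 \<one>\<^sub>2 u))"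
    using U(2) arr by (intro invertible_tensor2 invertible_id2) auto
  moreover have "equi_arrow C (?i \<otimes>\<^sub>1 (\<alpha> \<otimes>\<^sub>1 ?i)) (I \<otimes>\<^sub>0 ((I \<otimes>\<^sub>0 I) \<otimes>\<^sub>0 I)) (I \<otimes>\<^sub>0 (I \<otimes>\<^sub>0 I))"
    by (intro equi_arrow_tensor1 equi_arrow_id1 \<alpha> ob)
  ultimately show ?thesis
    using cylinderD(3)[OF C3] cylinderD(3)[OF C2] cylinderD(4)[OF C1] arr cell icell
    \<comment> \<open>The instance \<open>?uuu\<close> is the side along which the squares were
      pasted; it cannot be read off from \<open>C5\<close>.\<close>
    by (intro cylinder_cancel[OF C5, of ?uuu]) simp_all
qed

text \<open>\<open>F\<close> is a square from \<alpha> to \<beta> along \<open>ff\<close> and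
  \<open>f\<close>. Pasting the cylinder over \<open>A\<close> with the identity cylinder on
  \<open>F\<close> whiskers the associators by \<alpha> and \<beta>, and its commutation is the
  condition on semi-monoid maps.\<close>

lemma semi_monoid_map_if_cylinder:
  assumes f: "f \<in> hom1 C X Y" and \<alpha>: "\<alpha> \<in> hom1 C (X \<otimes>\<^sub>0 X) X" and \<beta>: "\<beta> \<in> hom1 C (Y \<otimes>\<^sub>0 Y) Y"
    and F: "F \<in> hom2 C (\<alpha> \<sharp>\<^sub>1 f) (f \<otimes>\<^sub>1 f \<sharp>\<^sub>1 \<beta>)" "invertible C F"
    and A: "A \<in> hom2 C (\<one>\<^sub>1 X \<otimes>\<^sub>1 \<alpha>) (\<alpha> \<otimes>\<^sub>1 \<one>\<^sub>1 X)" and B: "B \<in> hom2 C (\<one>\<^sub>1 Y \<otimes>\<^sub>1 \<beta>) (\<beta> \<otimes>\<^sub>1 \<one>\<^sub>1 Y)"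
    and cyl: "cylinder (f \<otimes>\<^sub>1 (f \<otimes>\<^sub>1 f)) (f \<otimes>\<^sub>1 f) A (\<one>\<^sub>2 f \<otimes>\<^sub>2 F) (F \<otimes>\<^sub>2 \<one>\<^sub>2 f) B"
  shows "semi_monoid_map C X \<alpha> (A \<sharp>\<^sub>2 \<one>\<^sub>2 \<alpha>) Y \<beta> (B \<sharp>\<^sub>2 \<one>\<^sub>2 \<beta>) f F"
proof -
  have ob: "X \<in> Obj C" "Y \<in> Obj C" using f Dom_Obj Cod_Obj by (auto simp: hom1_iff)
  note ty = f[unfolded hom1_iff] \<alpha>[unfolded hom1_iff] \<beta>[unfolded hom1_iff] F(1)[unfolded hom2_iff]
    A[unfolded hom2_iff] B[unfolded hom2_iff] ob
  have sq: "square \<alpha> (f \<otimes>\<^sub>1 f) f \<beta> F" using ty by (simp add: square_def hom2_iff)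
  \<comment> \<open>The target of \<open>\<alpha>X # F\<close> coincides with the source of
    \<open>Ff # \<beta>\<close>, as the rebracketing of the left-hand side below requires.\<close>
  have Ff: "(\<alpha> \<otimes>\<^sub>1 \<one>\<^sub>1 X) \<sharp>\<^sub>1 ((f \<otimes>\<^sub>1 f) \<sharp>\<^sub>1 \<beta>) = ((\<alpha> \<sharp>\<^sub>1 f) \<otimes>\<^sub>1 f) \<sharp>\<^sub>1 \<beta>"
    using comp1_assoc[of "\<alpha> \<otimes>\<^sub>1 \<one>\<^sub>1 X" "f \<otimes>\<^sub>1 f" \<beta>] ty by (simp add: tensor1_comp1)
  have "((A \<sharp>\<^sub>2 \<one>\<^sub>2 \<alpha>) \<sharp>\<^sub>2 \<one>\<^sub>2 f) \<bullet> paste (\<alpha> \<otimes>\<^sub>1 \<one>\<^sub>1 X) \<beta> (F \<otimes>\<^sub>2 \<one>\<^sub>2 f) F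
    = paste (\<one>\<^sub>1 X \<otimes>\<^sub>1 \<alpha>) \<beta> (\<one>\<^sub>2 f \<otimes>\<^sub>2 F) F \<bullet> (\<one>\<^sub>2 (f \<otimes>\<^sub>1 (f \<otimes>\<^sub>1 f)) \<sharp>\<^sub>2 (B \<sharp>\<^sub>2 \<one>\<^sub>2 \<beta>))"
    using cylinderD(5)[OF cylinder_paste[OF cyl cylinder_id[OF sq]]] ty by simp
  then have "((A \<sharp>\<^sub>2 \<one>\<^sub>2 \<alpha>) \<sharp>\<^sub>2 \<one>\<^sub>2 f) \<bullet> (\<one>\<^sub>2 (\<alpha> \<otimes>\<^sub>1 \<one>\<^sub>1 X) \<sharp>\<^sub>2 F) \<bullet> (F \<otimes>\<^sub>2 \<one>\<^sub>2 f \<sharp>\<^sub>2 \<one>\<^sub>2 \<beta>)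
    = (\<one>\<^sub>2 (\<one>\<^sub>1 X \<otimes>\<^sub>1 \<alpha>) \<sharp>\<^sub>2 F) \<bullet> (\<one>\<^sub>2 f \<otimes>\<^sub>2 F \<sharp>\<^sub>2 \<one>\<^sub>2 \<beta>) \<bullet>
      (\<one>\<^sub>2 (f \<otimes>\<^sub>1 f \<otimes>\<^sub>1 f) \<sharp>\<^sub>2 (B \<sharp>\<^sub>2 \<one>\<^sub>2 \<beta>))"
    unfolding paste_def using ty Ff
    by (subst vcomp_assoc') (simp_all add: tensor1_assoc tensor1_comp1 tensor0_assoc comp1_assoc)
  then show ?thesis using f F by (simp add: semi_monoid_map_def)
qed

end

theorem theoremB:
  fixes C :: "('o, 'a, 'c, 'r) semi_monoidal_scheme" (structure)
    and I\<^sub>0 I\<^sub>1 :: 'o and \<alpha>\<^sub>0 \<alpha>\<^sub>1 u :: 'a and A\<^sub>0 A\<^sub>1 U :: 'c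
  assumes "semi_monoidal_2category C"
    and "unit_object C I\<^sub>0 \<alpha>\<^sub>0"
    and "unit_object C I\<^sub>1 \<alpha>\<^sub>1"
    and "canonical_associator C I\<^sub>0 \<alpha>\<^sub>0 A\<^sub>0"
    and "canonical_associator C I\<^sub>1 \<alpha>\<^sub>1 A\<^sub>1"
    and "unit_morphism C I\<^sub>0 \<alpha>\<^sub>0 I\<^sub>1 \<alpha>\<^sub>1 u U"
  shows "semi_monoid_map C I\<^sub>0 \<alpha>\<^sub>0 (A\<^sub>0 \<sharp>\<^sub>2 \<one>\<^sub>2 \<alpha>\<^sub>0) I\<^sub>1 \<alpha>\<^sub>1 (A\<^sub>1 \<sharp>\<^sub>2 \<one>\<^sub>2 \<alpha>\<^sub>1) u U \<and>
         (A\<^sub>0 \<sharp>\<^sub>2 \<one>\<^sub>2 (u \<otimes>\<^sub>1 u)) \<bullet> (U \<otimes>\<^sub>2 \<one>\<^sub>2 u)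
           \<in> hom2 C (\<one>\<^sub>1 I\<^sub>0 \<otimes>\<^sub>1 \<alpha>\<^sub>0 \<sharp>\<^sub>1 u \<otimes>\<^sub>1 u) (u \<otimes>\<^sub>1 u \<otimes>\<^sub>1 u \<sharp>\<^sub>1 \<alpha>\<^sub>1 \<otimes>\<^sub>1 \<one>\<^sub>1 I\<^sub>1) \<and>
         (A\<^sub>0 \<sharp>\<^sub>2 \<one>\<^sub>2 (u \<otimes>\<^sub>1 u)) \<bullet> (U \<otimes>\<^sub>2 \<one>\<^sub>2 u)
           = (\<one>\<^sub>2 u \<otimes>\<^sub>2 U) \<bullet> (\<one>\<^sub>2 (u \<otimes>\<^sub>1 u \<otimes>\<^sub>1 u) \<sharp>\<^sub>2 A\<^sub>1)"
proof -
  interpret semi_monoidal_2category C by fact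
  have u: "equi_arrow C u I\<^sub>0 I\<^sub>1" and U: "U \<in> hom2 C (\<alpha>\<^sub>0 \<sharp>\<^sub>1 u) (u \<otimes>\<^sub>1 u \<sharp>\<^sub>1 \<alpha>\<^sub>1)" "invertible C U"
    using assms(6) by (simp_all add: unit_morphism_def)
  have I: "cancellable C I\<^sub>0" "equi_arrow C \<alpha>\<^sub>0 (I\<^sub>0 \<otimes>\<^sub>0 I\<^sub>0) I\<^sub>0" "equi_arrow C \<alpha>\<^sub>1 (I\<^sub>1 \<otimes>\<^sub>0 I\<^sub>1) I\<^sub>1"
    using assms(2,3) by (simp_all add: unit_object_def)
  have hom: "u \<in> hom1 C I\<^sub>0 I\<^sub>1" "\<alpha>\<^sub>0 \<in> hom1 C (I\<^sub>0 \<otimes>\<^sub>0 I\<^sub>0) I\<^sub>0" "\<alpha>\<^sub>1 \<in> hom1 C (I\<^sub>1 \<otimes>\<^sub>0 I\<^sub>1) I\<^sub>1"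
    using u I by (simp_all add: equi_arrow_def)
  have A: "A\<^sub>0 \<in> hom2 C (\<one>\<^sub>1 I\<^sub>0 \<otimes>\<^sub>1 \<alpha>\<^sub>0) (\<alpha>\<^sub>0 \<otimes>\<^sub>1 \<one>\<^sub>1 I\<^sub>0)" "A\<^sub>1 \<in> hom2 C (\<one>\<^sub>1 I\<^sub>1 \<otimes>\<^sub>1 \<alpha>\<^sub>1) (\<alpha>\<^sub>1 \<otimes>\<^sub>1 \<one>\<^sub>1 I\<^sub>1)"
    using assms(4,5) by (simp_all add: canonical_associator_def)
  \<comment> \<open>All three conclusions come from this cylinder: its typing, its commutation, and
    its pasting with the square \<open>U\<close>.\<close>
  have cyl: "cylinder (u \<otimes>\<^sub>1 (u \<otimes>\<^sub>1 u)) (u \<otimes>\<^sub>1 u) A\<^sub>0 (\<one>\<^sub>2 u \<otimes>\<^sub>2 U) (U \<otimes>\<^sub>2 \<one>\<^sub>2 u) A\<^sub>1"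
    by (rule associator_cylinder[OF u I(1,2) hom(3) U assms(4,5)])
  \<comment> \<open>The triple tensor in the statement is bracketed to the left, that of the
    cylinder to the right.\<close>
  have uuu: "u \<otimes>\<^sub>1 (u \<otimes>\<^sub>1 u) = u \<otimes>\<^sub>1 u \<otimes>\<^sub>1 u"
    using hom by (simp add: tensor1_assoc hom1_iff)
  have "(A\<^sub>0 \<sharp>\<^sub>2 \<one>\<^sub>2 (u \<otimes>\<^sub>1 u)) \<bullet> (U \<otimes>\<^sub>2 \<one>\<^sub>2 u)
      \<in> hom2 C (\<one>\<^sub>1 I\<^sub>0 \<otimes>\<^sub>1 \<alpha>\<^sub>0 \<sharp>\<^sub>1 u \<otimes>\<^sub>1 u) (u \<otimes>\<^sub>1 u \<otimes>\<^sub>1 u \<sharp>\<^sub>1 \<alpha>\<^sub>1 \<otimes>\<^sub>1 \<one>\<^sub>1 I\<^sub>1)"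
    using cylinderD(1,3,4)[OF cyl] A unfolding uuu square_def by (simp add: hom2_iff)
  moreover have "semi_monoid_map C I\<^sub>0 \<alpha>\<^sub>0 (A\<^sub>0 \<sharp>\<^sub>2 \<one>\<^sub>2 \<alpha>\<^sub>0) I\<^sub>1 \<alpha>\<^sub>1 (A\<^sub>1 \<sharp>\<^sub>2 \<one>\<^sub>2 \<alpha>\<^sub>1) u U"
    by (rule semi_monoid_map_if_cylinder[OF hom U A cyl])
  ultimately show ?thesis
    using cylinderD(5)[OF cyl, unfolded uuu] by simp
qed

end
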